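(* Let $d\geq 3$ and $n\geq 3$, and let $C_n$ be the cycle on $n$ vertices. If $d<n$, then $\mathcal{X}^d(C_n)$ is irreducible, while if $d\geq n$, then $\mathcal{X}^d(C_n)$ has two irreducible components, namely the picture variety $\mathcal{V}^d(C_n)$ and the indiscrete cellule $\mathcal{X}^d_I(C_n)$.
   Context: Let $\mathbb{F}$ be an algebraically closed field and $\mathbb{P}^d$ the projective $d$-space over $\mathbb{F}$. Let $G$ be a finite simple graph with vertex set $V$ and edge set $E$. A picture $P$ of $G$ in $\mathbb{P}^d$ consists of a point $P(v)\in\mathbb{P}^d$ for each vertex $v$ and a line $P(e)\subseteq\mathbb{P}^d$ for each edge $e$, such that $P(v)\in P(e)$ whenever $v$ is an endpoint of $e$. The picture space $\mathcal{X}^d(G)$ is the set of all pictures of $G$, regarded as a Zariski-closed (reduced) algebraic subset of the product of $|V|$ copies of $\mathbb{P}^d$ and $|E|$ copies of the Grassmannian of lines in $\mathbb{P}^d$. The picture variety $\mathcal{V}^d(G)$ is the Zariski closure in $\mathcal{X}^d(G)$ of the set of generic pictures, i.e., those for which the points $P(v)$, $v\in V$, are all different. The indiscrete cellule $\mathcal{X}^d_I(G)$ is the set of pictures for which all the points $P(v)$, $v\in V$, coincide. *)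

theory Defs
  imports "HOL-Analysis.Analysis" "HOL-Computational_Algebra.Polynomial"
begin

section \<open>Graphs\<close>

text \<open>A graph is a pair of a vertex set and a set of edges, an edge being the set of its endpoints.\<close>

type_synonym 'v graph = "'v set \<times> 'v set set"

abbreviation verts :: "'v graph \<Rightarrow> 'v set" where "verts G \<equiv> fst G"
abbreviation edges :: "'v graph \<Rightarrow> 'v set set" where "edges G \<equiv> snd G"

definition finite_simple_graph :: "'v graph \<Rightarrow> bool" where
  "finite_simple_graph G \<longleftrightarrow> finite (verts G) \<and> (\<forall>e\<in>edges G. e \<subseteq> verts G \<and> card e = 2)"

definition cycle_graph :: "nat \<Rightarrow> nat graph" where
  "cycle_graph n = ({..<n}, {{i, (i + 1) mod n} | i. i < n})"

lemma finite_edges: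
  assumes "finite_simple_graph G"
  shows "finite (edges G)"
proof (rule finite_subset)
  show "edges G \<subseteq> Pow (verts G)" "finite (Pow (verts G))"
    using assms by (auto simp: finite_simple_graph_def)
qed

lemma finite_simple_graph_cycle:
  assumes "n \<ge> 3"
  shows "finite_simple_graph (cycle_graph n)"
proof -
  have "i \<noteq> (i + 1) mod n" if "i < n" for i
    using assms that by (cases "i + 1 = n") auto
  then have "card {i, (i + 1) mod n} = 2" if "i < n" for i
    using that by (metis card_2_iff)
  then show ?thesis
    using assms by (auto simp: finite_simple_graph_def cycle_graph_def)
qed


section \<open>Points, lines and pictures\<close>

text \<open>The projective space of dimension \<open>d\<close> is that of the vector space \<open>'a ^ 'm\<close> with
  \<open>CARD('m) = d + 1\<close>. Points and lines are the linear subspaces of dimension 1 and 2, so that a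
  point lies on a line iff it is a subset of it.\<close>

definition proj_points :: "('a::field ^ 'm::finite) set set" where
  "proj_points = {p. vec.subspace p \<and> vec.dim p = 1}"

definition proj_lines :: "('a::field ^ 'm::finite) set set" where
  "proj_lines = {l. vec.subspace l \<and> vec.dim l = 2}"

type_synonym ('v, 'a, 'm) picture = "('v \<Rightarrow> ('a ^ 'm) set) \<times> ('v set \<Rightarrow> ('a ^ 'm) set)"

text \<open>The product of a copy of projective space for each vertex and a copy of the Grassmannian of
  lines for each edge. The functions are extensional, so that each family is represented once.\<close>

definition ambient :: "'v graph \<Rightarrow> ('v, 'a::field, 'm::finite) picture set" where
  "ambient G = (verts G \<rightarrow>\<^sub>E proj_points) \<times> (edges G \<rightarrow>\<^sub>E proj_lines)"

definition picture_space :: "'v graph \<Rightarrow> ('v, 'a::field, 'm::finite) picture set" where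
  "picture_space G = {(p, l) \<in> ambient G. \<forall>e\<in>edges G. \<forall>v\<in>e. p v \<subseteq> l e}"

definition generic_pictures :: "'v graph \<Rightarrow> ('v, 'a::field, 'm::finite) picture set" where
  "generic_pictures G = {(p, l) \<in> picture_space G. inj_on p (verts G)}"

definition indiscrete_cellule :: "'v graph \<Rightarrow> ('v, 'a::field, 'm::finite) picture set" where
  "indiscrete_cellule G = {(p, l) \<in> picture_space G. \<forall>v\<in>verts G. \<forall>w\<in>verts G. p v = p w}"


section \<open>The Zariski topology\<close>

text \<open>Pluecker coordinates are indexed by all ordered pairs rather than by \<open>i < j\<close>; the additional
  ones are zero or negatives of the others.\<close>

definition plucker :: "'a::field ^ 'm::finite \<Rightarrow> 'a ^ 'm \<Rightarrow> 'a ^ 'm ^ 'm" where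
  "plucker u w = (\<chi> i j. u $ i * w $ j - u $ j * w $ i)"

definition point_coords :: "('a::field ^ 'm::finite) set \<Rightarrow> ('a ^ 'm) set" where
  "point_coords p = {x. vec.span {x} = p}"

definition line_coords :: "('a::field ^ 'm::finite) set \<Rightarrow> ('a ^ 'm ^ 'm) set" where
  "line_coords l = {plucker u w | u w. vec.span {u, w} = l}"

text \<open>\<open>multihomogeneous G m k f\<close>: the function \<open>f\<close> is given by a multihomogeneous polynomial in
  the homogeneous coordinates of the points and the Pluecker coordinates of the lines, of degree
  \<open>m v\<close> in those of the vertex \<open>v\<close> and degree \<open>k e\<close> in those of the edge \<open>e\<close>.\<close>

inductive multihomogeneous ::
  "'v graph \<Rightarrow> ('v \<Rightarrow> nat) \<Rightarrow> ('v set \<Rightarrow> nat) \<Rightarrow>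
    (('v \<Rightarrow> 'a::field ^ 'm::finite) \<Rightarrow> ('v set \<Rightarrow> 'a ^ 'm ^ 'm) \<Rightarrow> 'a) \<Rightarrow> bool"
  for G :: "'v graph" where
  const: "multihomogeneous G (\<lambda>_. 0) (\<lambda>_. 0) (\<lambda>x y. c)"
| point_coord: "v \<in> verts G \<Longrightarrow>
    multihomogeneous G (\<lambda>v'. if v' = v then 1 else 0) (\<lambda>_. 0) (\<lambda>x y. x v $ i)"
| line_coord: "e \<in> edges G \<Longrightarrow>
    multihomogeneous G (\<lambda>_. 0) (\<lambda>e'. if e' = e then 1 else 0) (\<lambda>x y. y e $ i $ j)"
| add: "multihomogeneous G m k f \<Longrightarrow> multihomogeneous G m k g \<Longrightarrow>
    multihomogeneous G m k (\<lambda>x y. f x y + g x y)"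
| mult: "multihomogeneous G m k f \<Longrightarrow> multihomogeneous G m' k' g \<Longrightarrow>
    multihomogeneous G (\<lambda>v. m v + m' v) (\<lambda>e. k e + k' e) (\<lambda>x y. f x y * g x y)"

definition multihom_polys ::
  "'v graph \<Rightarrow> (('v \<Rightarrow> 'a::field ^ 'm::finite) \<Rightarrow> ('v set \<Rightarrow> 'a ^ 'm ^ 'm) \<Rightarrow> 'a) set" where
  "multihom_polys G = {f. \<exists>m k. multihomogeneous G m k f}"

definition coords ::
  "'v graph \<Rightarrow> ('v \<Rightarrow> ('a::field ^ 'm::finite) set) \<Rightarrow> ('v set \<Rightarrow> ('a ^ 'm) set) \<Rightarrow>
    ('v \<Rightarrow> 'a ^ 'm) \<Rightarrow> ('v set \<Rightarrow> 'a ^ 'm ^ 'm) \<Rightarrow> bool" where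
  "coords G p l x y \<longleftrightarrow>
    (\<forall>v\<in>verts G. x v \<in> point_coords (p v)) \<and> (\<forall>e\<in>edges G. y e \<in> line_coords (l e))"

text \<open>Vanishing is required at all coordinates of the picture; by \<open>multihom_vanish_independent\<close>
  below, this amounts to vanishing at one choice of them.\<close>

definition zero_locus ::
  "'v graph \<Rightarrow> (('v \<Rightarrow> 'a::field ^ 'm::finite) \<Rightarrow> ('v set \<Rightarrow> 'a ^ 'm ^ 'm) \<Rightarrow> 'a) set \<Rightarrow>
    ('v, 'a, 'm) picture set" where
  "zero_locus G S =
    {(p, l) \<in> ambient G. \<forall>f\<in>S. \<forall>x y. coords G p l x y \<longrightarrow> f x y = 0}"

definition zariski :: "'v graph \<Rightarrow> ('v, 'a::field, 'm::finite) picture topology" where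
  "zariski G = topology (\<lambda>U. \<exists>S \<subseteq> multihom_polys G. U = ambient G - zero_locus G S)"

definition picture_topology :: "'v graph \<Rightarrow> ('v, 'a::field, 'm::finite) picture topology" where
  "picture_topology G = subtopology (zariski G) (picture_space G)"

definition picture_variety :: "'v graph \<Rightarrow> ('v, 'a::field, 'm::finite) picture set" where
  "picture_variety G = picture_topology G closure_of generic_pictures G"


section \<open>Irreducibility\<close>

definition irreducible_in :: "'b topology \<Rightarrow> 'b set \<Rightarrow> bool" where
  "irreducible_in X S \<longleftrightarrow> S \<subseteq> topspace X \<and> S \<noteq> {} \<and>
    (\<forall>A B. closedin X A \<longrightarrow> closedin X B \<longrightarrow> S \<subseteq> A \<union> B \<longrightarrow> S \<subseteq> A \<or> S \<subseteq> B)"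

definition irreducible_components :: "'b topology \<Rightarrow> 'b set set" where
  "irreducible_components X =
    {S. irreducible_in X S \<and> (\<forall>T. irreducible_in X T \<longrightarrow> S \<subseteq> T \<longrightarrow> T = S)}"


section \<open>The Zariski topology is a topology\<close>

lemma plucker_lincomb:
  "plucker (a *s u + b *s w) (c *s u + d *s w) = (\<chi> i j. (a * d - b * c) * plucker u w $ i $ j)"
  by (simp add: plucker_def vec_eq_iff algebra_simps)

lemma in_span_pair: "x \<in> vec.span {u, w} \<Longrightarrow> \<exists>a b. x = a *s u + b *s (w :: 'a::field ^ 'm::finite)"
  by (auto simp: vec.span_insert vec.span_singleton) (metis add.commute diff_add_cancel)

lemma point_coords_scale:
  assumes "x \<in> point_coords p" "x' \<in> point_coords p"
  shows "\<exists>a. x' = a *s (x :: 'a::field ^ 'm::finite)"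
  using assms vec.span_base[of x' "{x'}"]
  by (auto simp: point_coords_def vec.span_singleton)

lemma line_coords_scale:
  assumes "y \<in> line_coords l" "y' \<in> line_coords l"
  shows "\<exists>b. y' = (\<chi> i j. b * (y :: 'a::field ^ 'm::finite ^ 'm) $ i $ j)"
proof -
  obtain u w u' w' where y: "y = plucker u w" "vec.span {u, w} = l"
    and y': "y' = plucker u' w'" "vec.span {u', w'} = l"
    using assms by (auto simp: line_coords_def)
  have "u' \<in> vec.span {u, w}" "w' \<in> vec.span {u, w}"
    using y y' vec.span_base[of _ "{u', w'}"] by auto
  then obtain a b c d where "u' = a *s u + b *s w" "w' = c *s u + d *s w"
    by (meson in_span_pair)
  then show ?thesis
    using y y' plucker_lincomb by blast
qed

lemma multihomogeneous_scale:
  assumes "multihomogeneous G m k f" "finite (verts G)" "finite (edges G)"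
    and "\<And>v. v \<in> verts G \<Longrightarrow> x' v = a v *s x v"
    and "\<And>e. e \<in> edges G \<Longrightarrow> y' e = (\<chi> i j. b e * y e $ i $ j)"
  shows "f x' y' = (\<Prod>v\<in>verts G. a v ^ m v) * (\<Prod>e\<in>edges G. b e ^ k e) * f x y"
  using assms
proof (induction rule: multihomogeneous.induct)
  case (mult m k f m' k' g)
  then show ?case
    by (simp add: power_add prod.distrib mult_ac)
qed (simp_all add: if_distrib[of "\<lambda>n. _ ^ n"] prod.delta' distrib_left cong: if_cong)

lemma multihom_vanish_independent:
  assumes "f \<in> multihom_polys G" "finite_simple_graph G" "f x y = 0"
    and "\<And>v. v \<in> verts G \<Longrightarrow> x v \<in> point_coords (p v) \<and> x' v \<in> point_coords (p v)"
    and "\<And>e. e \<in> edges G \<Longrightarrow> y e \<in> line_coords (l e) \<and> y' e \<in> line_coords (l e)"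
  shows "f x' y' = 0"
proof -
  have "\<forall>v\<in>verts G. \<exists>a. x' v = a *s x v"
    using point_coords_scale assms(4) by blast
  then obtain a where a: "\<And>v. v \<in> verts G \<Longrightarrow> x' v = a v *s x v"
    by metis
  have "\<forall>e\<in>edges G. \<exists>b. y' e = (\<chi> i j. b * y e $ i $ j)"
    using line_coords_scale assms(5) by blast
  then obtain b where b: "\<And>e. e \<in> edges G \<Longrightarrow> y' e = (\<chi> i j. b e * y e $ i $ j)"
    by metis
  obtain m k where "multihomogeneous G m k f"
    using assms(1) by (auto simp: multihom_polys_def)
  from multihomogeneous_scale[OF this _ _ a b] show ?thesis
    using assms(2,3) finite_edges[OF assms(2)] by (simp add: finite_simple_graph_def)
qed

lemma multihom_polys_mult:
  "f \<in> multihom_polys G \<Longrightarrow> g \<in> multihom_polys G \<Longrightarrow> (\<lambda>x y. f x y * g x y) \<in> multihom_polys G"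
  unfolding multihom_polys_def mem_Collect_eq by (elim exE) (rule exI, rule exI, rule multihomogeneous.mult)

lemma zero_locus_Un:
  assumes G: "finite_simple_graph G" and S: "S \<subseteq> multihom_polys G" "T \<subseteq> multihom_polys G"
  shows "zero_locus G S \<union> zero_locus G T = zero_locus G {\<lambda>x y. f x y * g x y | f g. f \<in> S \<and> g \<in> T}"
    (is "_ = zero_locus G ?ST")
proof -
  have locus: "(p, l) \<in> zero_locus G R \<longleftrightarrow>
      (p, l) \<in> ambient G \<and> (\<forall>f\<in>R. \<forall>x y. coords G p l x y \<longrightarrow> f x y = 0)" for p l R
    by (simp add: zero_locus_def)
  show ?thesis
proof (rule set_eqI, rule iffI)
  fix P assume P: "P \<in> zero_locus G S \<union> zero_locus G T"
  obtain p l where [simp]: "P = (p, l)" by fastforce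
  have "h x y = 0" if "h \<in> ?ST" and xy: "coords G p l x y" for h x y
  proof -
    obtain f g where h: "h = (\<lambda>x y. f x y * g x y)" "f \<in> S" "g \<in> T"
      using \<open>h \<in> ?ST\<close> by blast
    then have "f x y = 0 \<or> g x y = 0"
      using P xy by (auto simp: locus)
    then show ?thesis using h by auto
  qed
  moreover have "(p, l) \<in> ambient G"
    using P by (auto simp: locus)
  ultimately show "P \<in> zero_locus G ?ST"
    unfolding \<open>P = (p, l)\<close> locus by blast
next
  fix P assume P: "P \<in> zero_locus G ?ST"
  obtain p l where [simp]: "P = (p, l)" by fastforce
  show "P \<in> zero_locus G S \<union> zero_locus G T"
  proof (cases "P \<in> zero_locus G T")
    case False
    then obtain g x y where g: "g \<in> T" "g x y \<noteq> 0" and xy: "coords G p l x y"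
      using P by (auto simp: locus)
    have "f x' y' = 0" if f: "f \<in> S" and xy': "coords G p l x' y'" for f x' y'
    proof -
      have "g x' y' \<noteq> 0"
        using multihom_vanish_independent[OF _ G, of g x' y' p x l y] g xy xy' S
        by (auto simp: coords_def)
      moreover have fg: "(\<lambda>x y. f x y * g x y) \<in> ?ST"
        using f g by blast
      have "\<forall>h\<in>?ST. \<forall>x y. coords G p l x y \<longrightarrow> h x y = 0"
        using P unfolding \<open>P = (p, l)\<close> locus by (rule conjunct2)
      from bspec[OF this fg] have "f x' y' * g x' y' = 0"
        using xy' by blast
      ultimately show ?thesis by simp
    qed
    moreover have "(p, l) \<in> ambient G"
      using P by (simp add: locus)
    ultimately show ?thesis by (simp add: locus)
  qed simp
qed
qed

lemma zero_locus_subset: "zero_locus G S \<subseteq> ambient G"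
  by (auto simp: zero_locus_def)

lemma openin_zariski:
  fixes G :: "'v graph" and U :: "('v, 'a::field, 'm::finite) picture set"
  assumes G: "finite_simple_graph G"
  shows "openin (zariski G) U \<longleftrightarrow> (\<exists>S \<subseteq> multihom_polys G. U = ambient G - zero_locus G S)"
proof -
  define P where "P = (\<lambda>U :: ('v, 'a, 'm) picture set.
    \<exists>S \<subseteq> multihom_polys G. U = ambient G - zero_locus G S)"
  have "P (U \<inter> V)" if PU: "P U" and PV: "P V" for U V
  proof -
    obtain S where *: "S \<subseteq> multihom_polys G" "U = ambient G - zero_locus G S"
      using PU unfolding P_def by (elim exE conjE)
    obtain T where **: "T \<subseteq> multihom_polys G" "V = ambient G - zero_locus G T"
      using PV unfolding P_def by (elim exE conjE)
    note S = *(1) **(1) and UV = *(2) **(2)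
    let ?ST = "{\<lambda>x y. f x y * g x y | f g. f \<in> S \<and> g \<in> T}"
    have "U \<inter> V = ambient G - zero_locus G ?ST"
      unfolding UV zero_locus_Un[OF G S, symmetric] by (rule Diff_Un[symmetric])
    moreover have "?ST \<subseteq> multihom_polys G"
    proof
      fix h assume "h \<in> ?ST"
      then obtain f g where h: "h = (\<lambda>x y. f x y * g x y)" and "f \<in> S" "g \<in> T"
        by blast
      then show "h \<in> multihom_polys G"
        unfolding h using S by (intro multihom_polys_mult) (rule subsetD; assumption)+
    qed
    ultimately show ?thesis unfolding P_def by (intro exI conjI)
  qed
  moreover have "P (\<Union>K)" if PK: "\<forall>U\<in>K. P U" for K
  proof -
    obtain S where SK: "\<forall>U\<in>K. S U \<subseteq> multihom_polys G \<and> U = ambient G - zero_locus G (S U)"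
      using bchoice[OF PK[unfolded P_def]] by (rule exE)
    note S = conjunct1[OF bspec[OF SK]] conjunct2[OF bspec[OF SK]]
    have "\<Union>K = \<Union>((\<lambda>U. U) ` K)"
      by simp
    also have "\<dots> = (\<Union>U\<in>K. ambient G - zero_locus G (S U))"
      by (rule SUP_cong[OF refl S(2)])
    also have "\<dots> = ambient G - zero_locus G (\<Union>U\<in>K. S U)"
    proof -
      have "zero_locus G (\<Union>U\<in>K. S U) = ambient G \<inter> (\<Inter>U\<in>K. zero_locus G (S U))"
        unfolding zero_locus_def by fastforce
      then show ?thesis by blast
    qed
    finally have "\<Union>K = ambient G - zero_locus G (\<Union>U\<in>K. S U)" .
    moreover have "(\<Union>U\<in>K. S U) \<subseteq> multihom_polys G"
      using S(1) by (rule UN_least)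
    ultimately show ?thesis
      unfolding P_def by (intro exI conjI)
  qed
  ultimately have "istopology P"
    unfolding istopology_def by blast
  then have "openin (topology P) = P"
    by (rule topology_inverse')
  then show ?thesis
    unfolding zariski_def P_def by (rule fun_cong)
qed

lemma topspace_zariski:
  fixes G :: "'v graph"
  assumes G: "finite_simple_graph G"
  shows "topspace (zariski G :: ('v, 'a::field, 'm::finite) picture topology) = ambient G"
proof (rule subset_antisym)
  obtain S where "topspace (zariski G :: ('v, 'a, 'm) picture topology) = ambient G - zero_locus G S"
    using openin_topspace[of "zariski G", unfolded openin_zariski[OF G]] by (elim exE conjE)
  then show "topspace (zariski G) \<subseteq> (ambient G :: ('v, 'a, 'm) picture set)"
    by (rule ord_eq_le_trans[OF _ Diff_subset])
  have ne: "\<exists>x. x \<in> point_coords p" if pl: "p \<in> proj_points" for p :: "('a ^ 'm) set"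
  proof -
    have sub: "vec.subspace p" and dim: "vec.dim p = 1"
      using pl unfolding proj_points_def by simp_all
    obtain B where B: "B \<subseteq> p" "vec.independent B" "p \<subseteq> vec.span B" "card B = vec.dim p"
      by (rule vec.basis_exists)
    note card = B(4)[unfolded dim]
    have "vec.span B = p"
      by (rule vec.span_subspace[OF B(1,3) sub])
    moreover from card obtain x where "B = {x}"
      by (rule card_1_singletonE)
    ultimately have "x \<in> point_coords p"
      unfolding point_coords_def by simp
    then show ?thesis ..
  qed
  have ne': "\<exists>y. y \<in> line_coords l" if pl: "l \<in> proj_lines" for l :: "('a ^ 'm) set"
  proof -
    have sub: "vec.subspace l" and dim: "vec.dim l = 2"
      using pl unfolding proj_lines_def by simp_all
    obtain B where B: "B \<subseteq> l" "vec.independent B" "l \<subseteq> vec.span B" "card B = vec.dim l"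
      by (rule vec.basis_exists)
    note card = B(4)[unfolded dim]
    have "vec.span B = l"
      by (rule vec.span_subspace[OF B(1,3) sub])
    moreover obtain u w where "B = {u, w}"
      using card unfolding card_2_iff by (elim exE conjE)
    ultimately have "plucker u w \<in> line_coords l"
      unfolding line_coords_def by blast
    then show ?thesis ..
  qed
  let ?one = "\<lambda>(x :: 'v \<Rightarrow> 'a ^ 'm) (y :: 'v set \<Rightarrow> 'a ^ 'm ^ 'm). 1 :: 'a"
  have "P \<notin> zero_locus G {?one}" for P
  proof
    assume P: "P \<in> zero_locus G {?one}"
    obtain p l where pl: "P = (p, l)" by fastforce
    have pl_amb: "(p, l) \<in> ambient G" and van: "\<not> coords G p l x y" for x y
      using P unfolding pl zero_locus_def by simp_all
    have "\<forall>v\<in>verts G. \<exists>x. x \<in> point_coords (p v)"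
      using pl_amb ne unfolding ambient_def by (simp add: PiE_iff)
    from bchoice[OF this] obtain x where x: "\<forall>v\<in>verts G. x v \<in> point_coords (p v)"
      by (rule exE)
    have "\<forall>e\<in>edges G. \<exists>y. y \<in> line_coords (l e)"
      using pl_amb ne' unfolding ambient_def by (simp add: PiE_iff)
    from bchoice[OF this] obtain y where "\<forall>e\<in>edges G. y e \<in> line_coords (l e)"
      by (rule exE)
    with x have "coords G p l x y"
      unfolding coords_def by (rule conjI)
    with van show False by (rule notE)
  qed
  then have "zero_locus G {?one} = {}"
    by (simp add: set_eq_iff)
  then have amb: "ambient G = ambient G - zero_locus G {?one}"
    by simp
  have "?one \<in> multihom_polys G"
    unfolding multihom_polys_def mem_Collect_eq by (rule exI, rule exI, rule multihomogeneous.const)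
  then have "{?one} \<subseteq> multihom_polys G"
    by simp
  with amb have "openin (zariski G) (ambient G :: ('v, 'a, 'm) picture set)"
    unfolding openin_zariski[OF G] by (intro exI conjI)
  then show "(ambient G :: ('v, 'a, 'm) picture set) \<subseteq> topspace (zariski G)"
    by (rule openin_subset)
qed

lemma closedin_zariski:
  fixes G :: "'v graph" and Z :: "('v, 'a::field, 'm::finite) picture set"
  assumes G: "finite_simple_graph G"
  shows "closedin (zariski G) Z \<longleftrightarrow> (\<exists>S \<subseteq> multihom_polys G. Z = zero_locus G S)"
proof -
  have *: "Z \<subseteq> ambient G \<and> ambient G - Z = ambient G - zero_locus G S \<longleftrightarrow> Z = zero_locus G S" for S
    using zero_locus_subset[of G S] by auto
  have "closedin (zariski G) Z \<longleftrightarrow>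
      (\<exists>S \<subseteq> multihom_polys G. Z \<subseteq> ambient G \<and> ambient G - Z = ambient G - zero_locus G S)"
    unfolding closedin_def topspace_zariski[OF G] openin_zariski[OF G]
    by (rule iffI; elim conjE exE; intro conjI exI)
  then show ?thesis
    unfolding * .
qed

lemma topspace_picture_topology:
  fixes G :: "'v graph"
  assumes "finite_simple_graph G"
  shows "topspace (picture_topology G :: ('v, 'a::field, 'm::finite) picture topology) = picture_space G"
  using topspace_zariski[OF assms] by (auto simp: picture_topology_def picture_space_def)

end

theory Submission
  imports Defs
begin

text \<open>
  Closures and irreducibility are tested on polynomial curves: if representing vectors of a picture
  depend polynomially on \<open>t\<close>, then a closed set which contains the picture for infinitely many \<open>t\<close>
  contains every picture on the curve. Lines in the space of representing vectors join any two generic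
  pictures, and any two indiscrete ones, so that both sets are irreducible.

  Let \<open>x\<^sub>i\<close> represent the points. A picture whose \<open>i\<close>-th line is spanned by \<open>x\<^sub>i\<close> and \<open>w\<^sub>i\<close>
  whenever \<open>x\<^sub>i = x\<^sub>i\<^sub>+\<^sub>1\<close> is a limit of generic ones as soon as the \<open>w\<^sub>i\<close> can be chosen to add up to
  0 around the cycle: separate the points to first order by partial sums of the \<open>w\<^sub>i\<close>. If some two
  consecutive points differ, \<open>w\<^sub>i\<close> is free for that edge and this is always possible. For an
  indiscrete picture with \<open>d < n\<close>, the \<open>n\<close> lines are linearly dependent in the \<open>d\<close>-dimensional
  quotient by the common point, which up to a further limit gives a relation with nonzero
  coefficients. For \<open>d \<ge> n\<close>, the lines of a generic picture span at most \<open>n\<close> dimensions, and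
  those of an indiscrete picture can span \<open>n + 1\<close>.
\<close>

text \<open>If the field were finite, the product of all linear factors \<open>[:- a, 1:]\<close>
  plus 1 would have positive degree and no root.\<close>

lemma infinite_alg_closed_field: "infinite (UNIV :: 'a::alg_closed_field set)"
proof
  assume fin: "finite (UNIV :: 'a set)"
  define p :: "'a poly" where "p = (\<Prod>a\<in>UNIV. [:- a, 1:]) + 1"
  have p: "poly p x = 1" for x
    using fin by (auto simp: p_def poly_prod)
  have "degree (\<Prod>a\<in>(UNIV :: 'a set). [:- a, 1:]) = card (UNIV :: 'a set)"
    by (subst degree_prod_sum_eq) auto
  then have "degree p > 0"
    using fin unfolding p_def by (subst degree_add_eq_left) (auto simp: card_gt_0_iff)
  then obtain x where "poly p x = 0"
    using alg_closed_imp_poly_has_root by blast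
  with p show False by simp
qed

section \<open>Polynomial curves\<close>

text \<open>Stated as a property of functions rather than with explicit polynomials, so that the
  closure rules below settle polynomial dependence on \<open>t\<close>.\<close>

definition poly_fun :: "('a::comm_ring_1 \<Rightarrow> 'a) \<Rightarrow> bool" where
  "poly_fun f \<longleftrightarrow> (\<exists>p. \<forall>t. f t = poly p t)"

lemma poly_fun_const [intro, simp]: "poly_fun (\<lambda>_. c)"
  unfolding poly_fun_def by (rule exI[of _ "[:c:]"]) simp

lemma poly_fun_ident [intro, simp]: "poly_fun (\<lambda>t. t)"
  unfolding poly_fun_def by (rule exI[of _ "[:0, 1:]"]) simp

lemma poly_fun_add [intro]: "poly_fun f \<Longrightarrow> poly_fun g \<Longrightarrow> poly_fun (\<lambda>t. f t + g t)"
  unfolding poly_fun_def by (metis poly_add)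

lemma poly_fun_diff [intro]: "poly_fun f \<Longrightarrow> poly_fun g \<Longrightarrow> poly_fun (\<lambda>t. f t - g t)"
  unfolding poly_fun_def by (metis poly_diff)

lemma poly_fun_mult [intro]: "poly_fun f \<Longrightarrow> poly_fun g \<Longrightarrow> poly_fun (\<lambda>t. f t * g t)"
  unfolding poly_fun_def by (metis poly_mult)

text \<open>A nonzero polynomial has only finitely many roots. Through this fact, vanishing at
  infinitely many parameters passes to every parameter.\<close>

lemma poly_fun_eq_0:
  fixes f :: "'a::idom \<Rightarrow> 'a"
  assumes "poly_fun f" "infinite {t. f t = 0}"
  shows "f t = 0"
proof -
  obtain p where p: "\<And>t. f t = poly p t"
    using assms(1) by (auto simp: poly_fun_def)
  with assms(2) have "p = 0"
    using poly_roots_finite[of p] by auto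
  with p show ?thesis by simp
qed

definition poly_vec :: "('a::field \<Rightarrow> 'a ^ 'm::finite) \<Rightarrow> bool" where
  "poly_vec u \<longleftrightarrow> (\<forall>i. poly_fun (\<lambda>t. u t $ i))"

lemma poly_vec_const [intro, simp]: "poly_vec (\<lambda>_. c)"
  by (simp add: poly_vec_def)

lemma poly_vec_add [intro]: "poly_vec u \<Longrightarrow> poly_vec w \<Longrightarrow> poly_vec (\<lambda>t. u t + w t)"
  by (simp add: poly_vec_def poly_fun_add poly_fun_diff poly_fun_mult)

lemma poly_vec_diff [intro]: "poly_vec u \<Longrightarrow> poly_vec w \<Longrightarrow> poly_vec (\<lambda>t. u t - w t)"
  by (simp add: poly_vec_def poly_fun_add poly_fun_diff poly_fun_mult)

lemma poly_vec_scale [intro]: "poly_fun f \<Longrightarrow> poly_vec u \<Longrightarrow> poly_vec (\<lambda>t. f t *s u t)"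
  by (simp add: poly_vec_def poly_fun_add poly_fun_diff poly_fun_mult)

lemma poly_fun_plucker:
  "poly_vec u \<Longrightarrow> poly_vec w \<Longrightarrow> poly_fun (\<lambda>t. plucker (u t) (w t) $ i $ j)"
  by (simp add: poly_vec_def plucker_def poly_fun_diff poly_fun_mult)

text \<open>Constants and the substituted coordinates are polynomial in \<open>t\<close>, and sums
  and products remain so.\<close>

lemma poly_fun_multihomogeneous:
  assumes "multihomogeneous G m k f"
    and "\<And>v i. v \<in> verts G \<Longrightarrow> poly_fun (\<lambda>t. x t v $ i)"
    and "\<And>e i j. e \<in> edges G \<Longrightarrow> poly_fun (\<lambda>t. y t e $ i $ j)"
  shows "poly_fun (\<lambda>t. f (x t) (y t))"
  using assms
  by (induction rule: multihomogeneous.induct) (simp_all add: poly_fun_add poly_fun_mult)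

text \<open>An entry that is nonzero at \<open>s\<close> is a nonzero polynomial in
  \<open>t\<close>. Independence at one parameter thus spreads to almost all.\<close>

lemma finite_plucker_zeros:
  assumes "poly_vec u" "poly_vec w" "plucker (u s) (w s) \<noteq> 0"
  shows "finite {t. plucker (u t) (w t) = 0}"
proof -
  obtain i j where "plucker (u s) (w s) $ i $ j \<noteq> 0"
    using assms(3) by (metis vec_eq_iff zero_index)
  then have "finite {t. plucker (u t) (w t) $ i $ j = 0}"
    using poly_fun_eq_0[OF poly_fun_plucker[OF assms(1,2)], of i j s] by blast
  then show ?thesis
    by (rule rev_finite_subset) (simp add: Collect_mono)
qed

section \<open>Points, lines and Pluecker coordinates\<close>

text \<open>With \<open>u $ i\<close> nonzero, the minors involving \<open>i\<close> force
  \<open>w\<close> to be the multiple of \<open>u\<close> by \<open>w $ i / u $ i\<close>.\<close>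

lemma plucker_eq_0_iff: "plucker u w = 0 \<longleftrightarrow> u = 0 \<or> (\<exists>c. w = c *s (u :: 'a::field ^ 'm::finite))"
proof
  assume *: "plucker u w = 0"
  have "\<exists>c. w = c *s u" if u: "u \<noteq> 0"
  proof -
    obtain i where i: "u $ i \<noteq> 0"
      using u by (metis vec_eq_iff zero_index)
    have "u $ i * w $ j - u $ j * w $ i = 0" for j
      using * by (simp add: plucker_def vec_eq_iff)
    then have "w = (w $ i / u $ i) *s u"
      using i by (simp add: vec_eq_iff field_simps)
    then show ?thesis ..
  qed
  then show "u = 0 \<or> (\<exists>c. w = c *s u)" by blast
qed (auto simp: plucker_def vec_eq_iff)

lemma span_eq_span_singleton_iff:
  assumes "u \<noteq> 0" "w \<noteq> 0"
  shows "vec.span {u} = vec.span {w} \<longleftrightarrow> plucker u w = (0 :: 'a::field ^ 'm::finite ^ 'm)"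
proof
  assume "vec.span {u} = vec.span {w}"
  then have "w \<in> vec.span {u}" by (simp add: vec.span_base)
  then show "plucker u w = 0"
    by (auto simp: plucker_eq_0_iff vec.span_singleton)
next
  assume "plucker u w = 0"
  then obtain c where c: "w = c *s u"
    using assms by (auto simp: plucker_eq_0_iff)
  moreover have "u = inverse c *s w"
    using assms c by auto
  ultimately have "u \<in> vec.span {w}" "w \<in> vec.span {u}"
    unfolding vec.span_singleton by blast+
  then show "vec.span {u} = vec.span {w}"
    by (simp add: vec.span_eq)
qed

lemma span_singleton_proj_points: "u \<noteq> 0 \<Longrightarrow> vec.span {u} \<in> proj_points"
  by (auto simp: proj_points_def)

lemma proj_pointsE:
  assumes "p \<in> proj_points"
  obtains u where "u \<noteq> 0" "p = vec.span {u}"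
proof -
  obtain B where B: "B \<subseteq> p" "vec.independent B" "p \<subseteq> vec.span B" "card B = vec.dim p"
    by (rule vec.basis_exists)
  moreover from B(4) obtain u where "B = {u}"
    using assms by (auto simp: proj_points_def card_1_singleton_iff)
  moreover have "p = vec.span B"
    using B assms vec.span_subspace[of B p] by (simp add: proj_points_def)
  ultimately show thesis
    using that by simp
qed

text \<open>The clause \<open>u \<noteq> w\<close> separates pairs from sets: for nonzero
  \<open>u = w\<close> the set \<open>{u, w}\<close> is still independent.\<close>

lemma independent_pair_iff:
  "vec.independent {u, w} \<and> u \<noteq> w \<longleftrightarrow> plucker u (w :: 'a::field ^ 'm::finite) \<noteq> 0"
proof -
  have "plucker u u = 0" by (simp add: plucker_def vec_eq_iff)
  moreover have "plucker u w = - plucker w u" by (simp add: plucker_def vec_eq_iff)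
  ultimately show ?thesis
    using plucker_eq_0_iff[of w u]
    by (cases "u = w") (auto simp: vec.independent_insert vec.span_singleton)
qed

lemma span_pair_proj_lines:
  assumes "plucker u w \<noteq> 0"
  shows "vec.span {u, w} \<in> proj_lines"
proof -
  have "vec.independent {u, w}" "u \<noteq> w"
    using assms independent_pair_iff by blast+
  then show ?thesis
    using vec.dim_eq_card_independent[of "{u, w}"] by (simp add: proj_lines_def)
qed

lemma proj_line_eq_span:
  assumes "l \<in> proj_lines" "u \<in> l" "w \<in> l" "plucker u w \<noteq> 0"
  shows "l = vec.span {u, w}"
proof -
  have "vec.independent {u, w}" "u \<noteq> w"
    using assms independent_pair_iff by blast+
  then have dim: "vec.dim (vec.span {u, w}) = vec.dim l"
    using assms vec.dim_eq_card_independent[of "{u, w}"] by (simp add: proj_lines_def)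
  have l: "vec.subspace l"
    using assms by (simp add: proj_lines_def)
  then have "vec.span {u, w} \<subseteq> l"
    using assms by (intro vec.span_minimal) simp_all
  with l dim show ?thesis
    using vec.subspace_dim_equal[of "vec.span {u, w}" l] by simp
qed

text \<open>By dimension, a line is not contained in the span of \<open>u\<close>. This supplies a
  spanning vector where consecutive points coincide.\<close>

lemma proj_line_second_point:
  assumes "l \<in> proj_lines" "u \<noteq> 0"
  obtains w where "w \<in> l" "plucker u w \<noteq> 0"
proof -
  have "\<not> l \<subseteq> vec.span {u}"
  proof
    assume "l \<subseteq> vec.span {u}"
    then have "vec.dim l \<le> card {u}"
      by (intro vec.dim_le_card) auto
    with assms show False by (simp add: proj_lines_def)
  qed
  then show thesis
    using assms that by (auto simp: plucker_eq_0_iff vec.span_singleton)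
qed

section \<open>Pictures of cycles\<close>

definition cyc_succ :: "nat \<Rightarrow> nat \<Rightarrow> nat" where
  "cyc_succ n i = (i + 1) mod n"

definition cyc_edge :: "nat \<Rightarrow> nat \<Rightarrow> nat set" where
  "cyc_edge n i = {i, cyc_succ n i}"

text \<open>Inverse of the edge numbering, by which families indexed by edges become families
  indexed by \<open>i < n\<close>.\<close>

definition cyc_index :: "nat \<Rightarrow> nat set \<Rightarrow> nat" where
  "cyc_index n = the_inv_into {..<n} (cyc_edge n)"

lemma cyc_succ_less: "i < n \<Longrightarrow> cyc_succ n i < n"
  by (simp add: cyc_succ_def)

lemma cyc_succ_cases: "i < n \<Longrightarrow> cyc_succ n i = (if i + 1 = n then 0 else i + 1)"
  by (simp add: cyc_succ_def)

text \<open>Distinct \<open>i\<close> and \<open>j\<close> give the same edge only if they are each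
  other's successors, which takes a cycle of length 2.\<close>

lemma inj_on_cyc_edge: "n \<ge> 3 \<Longrightarrow> inj_on (cyc_edge n) {..<n}"
  unfolding inj_on_def cyc_edge_def
  by (auto simp: cyc_succ_cases doubleton_eq_iff split: if_splits)

lemma verts_cycle: "verts (cycle_graph n) = {..<n}"
  by (simp add: cycle_graph_def)

lemma edges_cycle: "edges (cycle_graph n) = cyc_edge n ` {..<n}"
  by (auto simp: cycle_graph_def cyc_edge_def cyc_succ_def)

lemma cyc_index_edge: "n \<ge> 3 \<Longrightarrow> i < n \<Longrightarrow> cyc_index n (cyc_edge n i) = i"
  unfolding cyc_index_def by (simp add: the_inv_into_f_f inj_on_cyc_edge)

text \<open>The \<open>i\<close>-th line joins the vertices \<open>i\<close> and \<open>i + 1\<close>. Its incidence with the former is built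
  into the parametrization, that with the latter is required in \<open>cyc_valid\<close> below.\<close>

definition cyc_pic ::
  "nat \<Rightarrow> (nat \<Rightarrow> 'a::field ^ 'm::finite) \<Rightarrow> (nat \<Rightarrow> 'a ^ 'm) \<Rightarrow> (nat, 'a, 'm) picture" where
  "cyc_pic n x b =
    (\<lambda>i\<in>{..<n}. vec.span {x i},
     \<lambda>e\<in>cyc_edge n ` {..<n}. vec.span {x (cyc_index n e), b (cyc_index n e)})"

definition cyc_plucker ::
  "nat \<Rightarrow> (nat \<Rightarrow> 'a::field ^ 'm::finite) \<Rightarrow> (nat \<Rightarrow> 'a ^ 'm) \<Rightarrow> nat set \<Rightarrow> 'a ^ 'm ^ 'm" where
  "cyc_plucker n x b e = plucker (x (cyc_index n e)) (b (cyc_index n e))"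

definition cyc_valid :: "nat \<Rightarrow> (nat \<Rightarrow> 'a::field ^ 'm::finite) \<Rightarrow> (nat \<Rightarrow> 'a ^ 'm) \<Rightarrow> bool" where
  "cyc_valid n x b \<longleftrightarrow>
    (\<forall>i<n. plucker (x i) (b i) \<noteq> 0 \<and> x (cyc_succ n i) \<in> vec.span {x i, b i})"

lemma cyc_valid_nonzero: "cyc_valid n x b \<Longrightarrow> i < n \<Longrightarrow> x i \<noteq> 0"
  by (auto simp: cyc_valid_def plucker_eq_0_iff)

lemma cyc_pic_cong:
  assumes "n \<ge> 3" "\<And>i. i < n \<Longrightarrow> vec.span {x i} = vec.span {x' i}"
    and "\<And>i. i < n \<Longrightarrow> vec.span {x i, b i} = vec.span {x' i, b' i}"
  shows "cyc_pic n x b = cyc_pic n x' b'"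
  using assms by (auto simp: cyc_pic_def cyc_index_edge fun_eq_iff)

lemma cyc_pic_in_picture_space:
  assumes "n \<ge> 3" "cyc_valid n x b"
  shows "cyc_pic n x b \<in> picture_space (cycle_graph n)"
proof -
  have "vec.span {x i} \<in> proj_points" if "i < n" for i
    using assms that by (simp add: span_singleton_proj_points cyc_valid_nonzero)
  moreover have "vec.span {x i, b i} \<in> proj_lines" if "i < n" for i
    using assms that by (simp add: span_pair_proj_lines cyc_valid_def)
  moreover have "vec.span {x v} \<subseteq> vec.span {x i, b i}" if "i < n" "v \<in> cyc_edge n i" for v i
  proof -
    have "x v \<in> vec.span {x i, b i}"
      using that assms by (auto simp: cyc_edge_def cyc_valid_def intro: vec.span_base)
    then show ?thesis
      by (intro vec.span_minimal) auto
  qed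
  moreover have "v < n" if "i < n" "v \<in> cyc_edge n i" for v i
    using that by (auto simp: cyc_edge_def cyc_succ_less)
  ultimately show ?thesis
    using assms(1)
    by (auto simp: picture_space_def ambient_def cyc_pic_def verts_cycle edges_cycle cyc_index_edge)
qed

lemma coords_cyc_pic:
  assumes "n \<ge> 3"
  shows "coords (cycle_graph n) (fst (cyc_pic n x b)) (snd (cyc_pic n x b)) x (cyc_plucker n x b)"
  using assms
  by (auto simp: coords_def cyc_pic_def verts_cycle edges_cycle cyc_index_edge point_coords_def
      line_coords_def cyc_plucker_def)

text \<open>The representing vector depends on the point rather than on the vertex, so equal points
  receive equal vectors. Where the next vector differs, it is itself the second spanning vector of
  the line; elsewhere any vector of the line independent of \<open>x i\<close> will do.\<close>

lemma cyc_pic_exhaust: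
  assumes n: "n \<ge> 3" and P: "(p, l) \<in> picture_space (cycle_graph n)"
  obtains x b where "cyc_valid n x b" "(p, l) = cyc_pic n x b"
    and "\<And>i j. i < n \<Longrightarrow> j < n \<Longrightarrow> p i = p j \<Longrightarrow> x i = x j"
    and "\<And>i. i < n \<Longrightarrow> x (cyc_succ n i) \<noteq> x i \<Longrightarrow> b i = x (cyc_succ n i)"
proof -
  have pt: "p i \<in> proj_points" if "i < n" for i
    using P that by (auto simp: picture_space_def ambient_def verts_cycle)
  have ln: "l (cyc_edge n i) \<in> proj_lines" if "i < n" for i
    using P that by (auto simp: picture_space_def ambient_def edges_cycle)
  have inc: "p i \<subseteq> l (cyc_edge n i)" "p (cyc_succ n i) \<subseteq> l (cyc_edge n i)" if "i < n" for i
    using P that by (auto simp: picture_space_def edges_cycle cyc_edge_def)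
  have "\<exists>u. u \<noteq> 0 \<and> q = vec.span {u}" if "q \<in> proj_points" for q :: "('a ^ 'b) set"
    using that by (rule proj_pointsE) blast
  then obtain r :: "('a ^ 'b) set \<Rightarrow> 'a ^ 'b"
    where r: "\<And>q. q \<in> proj_points \<Longrightarrow> r q \<noteq> 0 \<and> q = vec.span {r q}"
    by metis
  define x where "x i = r (p i)" for i
  have x: "x i \<noteq> 0" "p i = vec.span {x i}" if "i < n" for i
    using r[OF pt[OF that]] unfolding x_def by blast+
  \<comment> \<open>Dependent vectors span the same point and are equal by the choice of
    \<open>r\<close>; different representing vectors are therefore independent.\<close>
  have x_eq: "x i = x j" if "i < n" "j < n" "plucker (x i) (x j) = 0" for i j
  proof -
    have "p i = p j"
      using that x(2)[of i] x(2)[of j] span_eq_span_singleton_iff[OF x(1) x(1), of i j] by metis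
    then show ?thesis by (simp add: x_def)
  qed
  have xl: "x i \<in> l (cyc_edge n i)" "x (cyc_succ n i) \<in> l (cyc_edge n i)" if "i < n" for i
    using inc[OF that] x[OF that] x[OF cyc_succ_less[OF that]] vec.span_base by blast+
  have "\<exists>w. w \<in> l (cyc_edge n i) \<and> plucker (x i) w \<noteq> 0 \<and>
      (x (cyc_succ n i) \<noteq> x i \<longrightarrow> w = x (cyc_succ n i))" if "i < n" for i
  proof (cases "x (cyc_succ n i) = x i")
    case True
    then show ?thesis
      using proj_line_second_point[OF ln x(1), of i] that by metis
  next
    case False
    then show ?thesis
      using xl x_eq[OF that cyc_succ_less] that by metis
  qed
  then obtain b where b: "\<And>i. i < n \<Longrightarrow> b i \<in> l (cyc_edge n i) \<and> plucker (x i) (b i) \<noteq> 0 \<and>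
      (x (cyc_succ n i) \<noteq> x i \<longrightarrow> b i = x (cyc_succ n i))"
    by metis
  have l: "l (cyc_edge n i) = vec.span {x i, b i}" if "i < n" for i
    using proj_line_eq_span ln xl b that by blast
  show thesis
  proof (rule that)
    show "cyc_valid n x b"
      using b l xl by (auto simp: cyc_valid_def)
    have "p \<in> extensional {..<n}" "l \<in> extensional (cyc_edge n ` {..<n})"
      using P by (auto simp: picture_space_def ambient_def verts_cycle edges_cycle PiE_def)
    then show "(p, l) = cyc_pic n x b"
      using x l n by (auto simp: cyc_pic_def cyc_index_edge fun_eq_iff extensional_def)
  qed (use b in \<open>auto simp: x_def\<close>)
qed

section \<open>Genericity and closed conditions in terms of representing vectors\<close>

lemma cyc_pic_in_generic_pictures:
  assumes "n \<ge> 3" "cyc_valid n x b"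
  shows "cyc_pic n x b \<in> generic_pictures (cycle_graph n) \<longleftrightarrow>
    (\<forall>i<n. \<forall>j<n. i \<noteq> j \<longrightarrow> plucker (x i) (x j) \<noteq> 0)"
proof -
  have "cyc_pic n x b \<in> generic_pictures (cycle_graph n) \<longleftrightarrow>
      inj_on (\<lambda>i. vec.span {x i}) {..<n}"
    using cyc_pic_in_picture_space[OF assms]
    by (auto simp: generic_pictures_def cyc_pic_def verts_cycle inj_on_def)
  also have "\<dots> \<longleftrightarrow> (\<forall>i<n. \<forall>j<n. i \<noteq> j \<longrightarrow> plucker (x i) (x j) \<noteq> 0)"
    using span_eq_span_singleton_iff cyc_valid_nonzero[OF assms(2)]
    unfolding inj_on_def by (metis lessThan_iff)
  finally show ?thesis .
qed

text \<open>Vanishing at one choice of coordinates implies vanishing at all of them by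
  multihomogeneity, so those read off from \<open>x\<close> and \<open>b\<close> suffice.\<close>

lemma cyc_pic_in_zero_locus:
  assumes n: "n \<ge> 3" and v: "cyc_valid n x b" and S: "S \<subseteq> multihom_polys (cycle_graph n)"
  shows "cyc_pic n x b \<in> zero_locus (cycle_graph n) S \<longleftrightarrow> (\<forall>f\<in>S. f x (cyc_plucker n x b) = 0)"
proof -
  let ?G = "cycle_graph n"
  note G = finite_simple_graph_cycle[OF n]
  obtain p l where pl: "cyc_pic n x b = (p, l)" by fastforce
  have co: "coords ?G p l x (cyc_plucker n x b)"
    using coords_cyc_pic[OF n, of x b] pl by simp
  have "(p, l) \<in> ambient ?G"
    using cyc_pic_in_picture_space[OF n v] pl by (simp add: picture_space_def)
  then have "(p, l) \<in> zero_locus ?G S \<longleftrightarrow> (\<forall>f\<in>S. \<forall>x y. coords ?G p l x y \<longrightarrow> f x y = 0)"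
    by (simp add: zero_locus_def)
  moreover have "f x' y' = 0"
    if f: "f \<in> S" "f x (cyc_plucker n x b) = 0" and co': "coords ?G p l x' y'" for f x' y'
  proof (rule multihom_vanish_independent[where f = f and x = x and y = "cyc_plucker n x b" and p = p and l = l, OF _ G f(2)])
    show "f \<in> multihom_polys ?G"
      using f(1) S by (rule rev_subsetD)
  qed (use co co' in \<open>simp_all add: coords_def\<close>)
  ultimately show ?thesis
    using co pl by metis
qed

text \<open>One set of polynomials serves for all valid pairs \<open>x\<close>, \<open>b\<close>, so
  closedness can be tested along a whole curve at once.\<close>

lemma closedin_picture_topology_cyc_pic:
  assumes n: "n \<ge> 3"
    and C: "closedin (picture_topology (cycle_graph n)) (C :: (nat, 'a::field, 'm::finite) picture set)"
  obtains S where "S \<subseteq> multihom_polys (cycle_graph n)"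
    and "\<And>x b. cyc_valid n x b \<Longrightarrow> cyc_pic n x b \<in> C \<longleftrightarrow> (\<forall>f\<in>S. f x (cyc_plucker n x b) = 0)"
proof -
  let ?G = "cycle_graph n"
  obtain Z where Z: "closedin (zariski ?G) Z" "C = Z \<inter> picture_space ?G"
    using C unfolding picture_topology_def closedin_subtopology by (elim exE conjE)
  obtain S where S: "S \<subseteq> multihom_polys ?G" "Z = zero_locus ?G S"
    using Z(1) unfolding closedin_zariski[OF finite_simple_graph_cycle[OF n]] by (elim exE conjE)
  show thesis
  proof (rule that[OF S(1)])
    fix x b :: "nat \<Rightarrow> 'a ^ 'm" assume v: "cyc_valid n x b"
    show "cyc_pic n x b \<in> C \<longleftrightarrow> (\<forall>f\<in>S. f x (cyc_plucker n x b) = 0)"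
      using cyc_pic_in_picture_space[OF n v] cyc_pic_in_zero_locus[OF n v S(1)]
      unfolding Z(2) S(2) by (simp only: Int_iff simp_thms)
  qed
qed

section \<open>Irreducible sets of pictures\<close>

text \<open>Along the curve every defining polynomial of \<open>C\<close> is a polynomial in
  \<open>t\<close> with infinitely many zeros, hence vanishes at \<open>s\<close> too.\<close>

lemma cyc_curve_closed:
  fixes C :: "(nat, 'a::field, 'm::finite) picture set"
  assumes n: "n \<ge> 3" and C: "closedin (picture_topology (cycle_graph n)) C"
    and x: "\<And>i. poly_vec (\<lambda>t. x t i)" and b: "\<And>i. poly_vec (\<lambda>t. b t i)"
    and inf: "infinite {t. cyc_valid n (x t) (b t) \<and> cyc_pic n (x t) (b t) \<in> C}"
    and s: "cyc_valid n (x s) (b s)"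
  shows "cyc_pic n (x s) (b s) \<in> C"
proof -
  obtain S where S: "S \<subseteq> multihom_polys (cycle_graph n)"
    and SC: "\<And>x b. cyc_valid n x b \<Longrightarrow> cyc_pic n x b \<in> C \<longleftrightarrow> (\<forall>f\<in>S. f x (cyc_plucker n x b) = 0)"
    using closedin_picture_topology_cyc_pic[OF n C] by metis
  have "f (x s) (cyc_plucker n (x s) (b s)) = 0" if f: "f \<in> S" for f
  proof -
    obtain m k where "multihomogeneous (cycle_graph n) m k f"
      using S f unfolding multihom_polys_def by blast
    then have "poly_fun (\<lambda>t. f (x t) (cyc_plucker n (x t) (b t)))"
    proof (rule poly_fun_multihomogeneous)
      show "poly_fun (\<lambda>t. x t v $ i)" for v i
        using x by (simp add: poly_vec_def)
      show "poly_fun (\<lambda>t. cyc_plucker n (x t) (b t) e $ i $ j)" for e i j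
        unfolding cyc_plucker_def by (rule poly_fun_plucker[OF x b])
    qed
    moreover have "infinite {t. f (x t) (cyc_plucker n (x t) (b t)) = 0}"
      by (rule infinite_super[OF _ inf]) (use SC f in blast)
    ultimately show ?thesis
      by (rule poly_fun_eq_0)
  qed
  then show ?thesis
    using SC[OF s] by blast
qed

lemma infinite_if_cofinite:
  assumes "infinite (UNIV :: 'a set)" "finite {t :: 'a. \<not> P t}"
  shows "infinite {t. P t}"
proof -
  have "UNIV = {t. P t} \<union> {t. \<not> P t}" by auto
  with assms show ?thesis
    by (metis finite_Un)
qed

text \<open>Suppose closed sets \<open>A\<close> and \<open>B\<close> cover \<open>S\<close> while
  \<open>P\<close> is outside \<open>A\<close> and \<open>Q\<close> outside \<open>B\<close>. One of
  them contains the picture on the curve for infinitely many parameters, and so contains both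
  \<open>P\<close> and \<open>Q\<close>.\<close>

lemma irreducible_in_cycI:
  fixes S :: "(nat, 'a::field, 'm::finite) picture set"
  assumes n: "n \<ge> 3" and inf: "infinite (UNIV :: 'a set)"
    and S: "S \<subseteq> picture_space (cycle_graph n)" "S \<noteq> {}"
    and curve: "\<And>P Q. P \<in> S \<Longrightarrow> Q \<in> S \<Longrightarrow> \<exists>x b. (\<forall>i. poly_vec (\<lambda>t. x t i)) \<and> (\<forall>i. poly_vec (\<lambda>t. b t i)) \<and>
      cyc_valid n (x 0) (b 0) \<and> P = cyc_pic n (x 0) (b 0) \<and>
      cyc_valid n (x 1) (b 1) \<and> Q = cyc_pic n (x 1) (b 1) \<and>
      finite {t. \<not> (cyc_valid n (x t) (b t) \<and> cyc_pic n (x t) (b t) \<in> S)}"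
  shows "irreducible_in (picture_topology (cycle_graph n)) S"
  unfolding irreducible_in_def topspace_picture_topology[OF finite_simple_graph_cycle[OF n]]
proof (intro conjI allI impI)
  fix A B :: "(nat, 'a, 'm) picture set"
  assume A: "closedin (picture_topology (cycle_graph n)) A"
    and B: "closedin (picture_topology (cycle_graph n)) B" and AB: "S \<subseteq> A \<union> B"
  show "S \<subseteq> A \<or> S \<subseteq> B"
  proof (rule ccontr)
    assume "\<not> (S \<subseteq> A \<or> S \<subseteq> B)"
    then obtain P Q where P: "P \<in> S" "P \<notin> A" and Q: "Q \<in> S" "Q \<notin> B"
      by blast
    obtain x b where x: "\<forall>i. poly_vec (\<lambda>t. x t i)" and b: "\<forall>i. poly_vec (\<lambda>t. b t i)"
      and x0: "cyc_valid n (x 0) (b 0)" "P = cyc_pic n (x 0) (b 0)"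
      and x1: "cyc_valid n (x 1) (b 1)" "Q = cyc_pic n (x 1) (b 1)"
      and fin: "finite {t. \<not> (cyc_valid n (x t) (b t) \<and> cyc_pic n (x t) (b t) \<in> S)}"
      using curve[OF P(1) Q(1)] by (elim exE conjE)
    have "infinite {t. cyc_valid n (x t) (b t) \<and> cyc_pic n (x t) (b t) \<in> S}"
      by (rule infinite_if_cofinite[OF inf fin])
    moreover have "{t. cyc_valid n (x t) (b t) \<and> cyc_pic n (x t) (b t) \<in> S} \<subseteq>
        {t. cyc_valid n (x t) (b t) \<and> cyc_pic n (x t) (b t) \<in> A} \<union>
        {t. cyc_valid n (x t) (b t) \<and> cyc_pic n (x t) (b t) \<in> B}" (is "_ \<subseteq> ?A \<union> ?B")
      using AB by blast
    ultimately have "infinite ?A \<or> infinite ?B"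
      by (meson finite_UnI finite_subset)
    then show False
      using cyc_curve_closed[OF n A spec[OF x] spec[OF b] _ x0(1)]
        cyc_curve_closed[OF n B spec[OF x] spec[OF b] _ x1(1)] P(2) Q(2) x0(2) x1(2) by blast
  qed
qed (use S in simp_all)

text \<open>A closed set contains \<open>S\<close> exactly if it contains the closure of
  \<open>S\<close>.\<close>

lemma irreducible_in_closure_of:
  assumes "irreducible_in X S"
  shows "irreducible_in X (X closure_of S)"
proof -
  have S: "S \<subseteq> X closure_of S" "S \<noteq> {}"
    using assms closure_of_subset by (auto simp: irreducible_in_def)
  show ?thesis
    unfolding irreducible_in_def
  proof (intro conjI allI impI)
    fix A B assume AB: "closedin X A" "closedin X B" "X closure_of S \<subseteq> A \<union> B"
    then have "S \<subseteq> A \<or> S \<subseteq> B"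
      using assms S unfolding irreducible_in_def by (meson order_trans)
    then show "X closure_of S \<subseteq> A \<or> X closure_of S \<subseteq> B"
      using AB closure_of_minimal by metis
  qed (use S closure_of_subset_topspace[of X S] in auto)
qed

section \<open>Exceptional parameters of a curve\<close>

lemma finite_not_cyc_valid:
  assumes "\<And>i. poly_vec (\<lambda>t. x t i)" "\<And>i. poly_vec (\<lambda>t. b t i)"
    and "\<And>i. i < n \<Longrightarrow> plucker (x s i) (b s i) \<noteq> 0"
    and "\<And>t i. i < n \<Longrightarrow> x t (cyc_succ n i) \<in> vec.span {x t i, b t i}"
  shows "finite {t. \<not> cyc_valid n (x t) (b t)}"
proof (rule finite_subset)
  \<comment> \<open>As incidence holds for all \<open>t\<close>, validity can fail only through a
    vanishing Pluecker matrix.\<close>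
  show "{t. \<not> cyc_valid n (x t) (b t)} \<subseteq> (\<Union>i\<in>{..<n}. {t. plucker (x t i) (b t i) = 0})"
    using assms(4) by (auto simp: cyc_valid_def)
  show "finite (\<Union>i\<in>{..<n}. {t. plucker (x t i) (b t i) = 0})"
    using finite_plucker_zeros[OF assms(1,2) assms(3)] by blast
qed

lemma finite_not_pairwise_independent:
  fixes n :: nat
  assumes "\<And>i. poly_vec (\<lambda>t. x t i)"
    and "\<And>i j. i < n \<Longrightarrow> j < n \<Longrightarrow> i \<noteq> j \<Longrightarrow> plucker (x s i) (x s j) \<noteq> 0"
  shows "finite {t. \<not> (\<forall>i<n. \<forall>j<n. i \<noteq> j \<longrightarrow> plucker (x t i) (x t j) \<noteq> 0)}"
proof (rule finite_subset)
  let ?I = "{(i, j) \<in> {..<n} \<times> {..<n}. i \<noteq> j}"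
  show "{t. \<not> (\<forall>i<n. \<forall>j<n. i \<noteq> j \<longrightarrow> plucker (x t i) (x t j) \<noteq> 0)} \<subseteq>
      (\<Union>(i, j)\<in>?I. {t. plucker (x t i) (x t j) = 0})"
    by auto
  have "finite ?I"
    by (rule finite_subset[of _ "{..<n} \<times> {..<n}"]) auto
  then show "finite (\<Union>(i, j)\<in>?I. {t. plucker (x t i) (x t j) = 0})"
    using finite_plucker_zeros[OF assms(1,1) assms(2)] by (intro finite_UN_I) auto
qed

lemma cyc_succ_neq: "n \<ge> 3 \<Longrightarrow> i < n \<Longrightarrow> cyc_succ n i \<noteq> i"
  by (auto simp: cyc_succ_cases)

section \<open>Parametrizations of the generic and the indiscrete pictures\<close>

lemma cyc_valid_generic:
  assumes "n \<ge> 3" "\<forall>i<n. \<forall>j<n. i \<noteq> j \<longrightarrow> plucker (x i) (x j) \<noteq> 0"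
  shows "cyc_valid n x (\<lambda>i. x (cyc_succ n i))"
  unfolding cyc_valid_def
proof (intro allI impI conjI)
  fix i assume "i < n"
  then show "plucker (x i) (x (cyc_succ n i)) \<noteq> 0"
    using assms cyc_succ_neq[OF assms(1)] cyc_succ_less by metis
qed (simp add: vec.span_base)

text \<open>Consecutive points of a generic picture differ, so each line is their join and the
  points alone determine the picture.\<close>

lemma generic_pictures_cycle:
  assumes n: "n \<ge> 3"
  shows "(P :: (nat, 'a::field, 'm::finite) picture) \<in> generic_pictures (cycle_graph n) \<longleftrightarrow>
    (\<exists>x. (\<forall>i<n. \<forall>j<n. i \<noteq> j \<longrightarrow> plucker (x i) (x j) \<noteq> 0) \<and> P = cyc_pic n x (\<lambda>i. x (cyc_succ n i)))"
proof
  assume P: "P \<in> generic_pictures (cycle_graph n)"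
  obtain p l where pl: "P = (p, l)" by fastforce
  have "(p, l) \<in> picture_space (cycle_graph n)"
    using P pl by (auto simp: generic_pictures_def)
  then obtain x b where v: "cyc_valid n x b" "(p, l) = cyc_pic n x b"
    and b: "\<And>i. i < n \<Longrightarrow> x (cyc_succ n i) \<noteq> x i \<Longrightarrow> b i = x (cyc_succ n i)"
    using cyc_pic_exhaust[OF n] by metis
  have x: "\<forall>i<n. \<forall>j<n. i \<noteq> j \<longrightarrow> plucker (x i) (x j) \<noteq> 0"
    using P pl v cyc_pic_in_generic_pictures[OF n v(1)] by simp
  have "b i = x (cyc_succ n i)" if "i < n" for i
  proof -
    have "plucker (x i) (x (cyc_succ n i)) \<noteq> 0"
      using x cyc_succ_neq[OF n that] cyc_succ_less[OF that] that by metis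
    then have "x (cyc_succ n i) \<noteq> x i"
      using plucker_eq_0_iff[of "x i" "x i"] by (metis vector_smult_lid)
    with b that show ?thesis by blast
  qed
  then have "P = cyc_pic n x (\<lambda>i. x (cyc_succ n i))"
    unfolding pl v(2) by (intro cyc_pic_cong[OF n]) auto
  with x show "\<exists>x. (\<forall>i<n. \<forall>j<n. i \<noteq> j \<longrightarrow> plucker (x i) (x j) \<noteq> 0) \<and> P = cyc_pic n x (\<lambda>i. x (cyc_succ n i))"
    by blast
next
  assume "\<exists>x. (\<forall>i<n. \<forall>j<n. i \<noteq> j \<longrightarrow> plucker (x i) (x j) \<noteq> 0) \<and> P = cyc_pic n x (\<lambda>i. x (cyc_succ n i))"
  then show "P \<in> generic_pictures (cycle_graph n)"
    using cyc_pic_in_generic_pictures[OF n cyc_valid_generic[OF n]] by blast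
qed

lemma indiscrete_cellule_cycle:
  assumes n: "n \<ge> 3"
  shows "(P :: (nat, 'a::field, 'm::finite) picture) \<in> indiscrete_cellule (cycle_graph n) \<longleftrightarrow>
    (\<exists>u b. (\<forall>i<n. plucker u (b i) \<noteq> 0) \<and> P = cyc_pic n (\<lambda>_. u) b)"
proof
  assume P: "P \<in> indiscrete_cellule (cycle_graph n)"
  obtain p l where pl: "P = (p, l)" by fastforce
  have "(p, l) \<in> picture_space (cycle_graph n)"
    using P pl by (auto simp: indiscrete_cellule_def)
  then obtain x b where v: "cyc_valid n x b" "(p, l) = cyc_pic n x b"
    and xp: "\<And>i j. i < n \<Longrightarrow> j < n \<Longrightarrow> p i = p j \<Longrightarrow> x i = x j"
    using cyc_pic_exhaust[OF n] by metis
  have n0: "0 < n"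
    using n by simp
  have p0: "p i = p 0" if "i < n" for i
  proof -
    have "\<forall>v\<in>{..<n}. \<forall>w\<in>{..<n}. p v = p w"
      using P unfolding pl indiscrete_cellule_def verts_cycle mem_Collect_eq prod.case
      by (rule conjunct2)
    moreover have "i \<in> {..<n}" "0 \<in> {..<n}"
      using that n0 by simp_all
    ultimately show ?thesis by blast
  qed
  have x: "x i = x 0" if "i < n" for i
    by (rule xp[OF that n0 p0[OF that]])
  have "P = cyc_pic n (\<lambda>_. x 0) b"
    unfolding pl v(2) by (rule cyc_pic_cong[OF n]; subst x; simp)
  moreover have "\<forall>i<n. plucker (x 0) (b i) \<noteq> 0"
    using v(1) x unfolding cyc_valid_def by metis
  ultimately show "\<exists>u b. (\<forall>i<n. plucker u (b i) \<noteq> 0) \<and> P = cyc_pic n (\<lambda>_. u) b"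
    by blast
next
  assume "\<exists>u b. (\<forall>i<n. plucker u (b i) \<noteq> 0) \<and> P = cyc_pic n (\<lambda>_. u) b"
  then obtain u b where ub: "\<forall>i<n. plucker u (b i) \<noteq> 0" "P = cyc_pic n (\<lambda>_. u) b"
    by (elim exE conjE)
  then have "cyc_valid n (\<lambda>_. u) b"
    by (simp add: cyc_valid_def vec.span_base)
  then have "P \<in> picture_space (cycle_graph n)"
    unfolding ub(2) by (rule cyc_pic_in_picture_space[OF n])
  then show "P \<in> indiscrete_cellule (cycle_graph n)"
    unfolding ub(2) by (simp add: indiscrete_cellule_def cyc_pic_def verts_cycle)
qed

text \<open>Distinct scalars \<open>s i\<close> give distinct points on the line through two
  coordinate points; the minor for \<open>k\<close>, \<open>l\<close> is \<open>s j - s i\<close>.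
  The family shows that generic pictures exist and serves to perturb other pictures.\<close>

lemma pairwise_independent_family:
  assumes "infinite (UNIV :: 'a set)" "CARD('m) \<ge> 2"
  shows "\<exists>g :: nat \<Rightarrow> 'a::field ^ 'm::finite. \<forall>i j. i \<noteq> j \<longrightarrow> plucker (g i) (g j) \<noteq> 0"
proof -
  obtain s :: "nat \<Rightarrow> 'a" where s: "inj s"
    using assms(1) infinite_countable_subset by blast
  obtain k l :: 'm where kl: "k \<noteq> l"
  proof (rule ccontr)
    assume "\<not> thesis"
    with that have "UNIV = {undefined :: 'm}" by blast
    then have "CARD('m) = 1" by (metis card_1_singleton_iff One_nat_def)
    with assms(2) show False by simp
  qed
  define g :: "nat \<Rightarrow> 'a ^ 'm" where "g i = axis k 1 + s i *s axis l 1" for i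
  have "plucker (g i) (g j) $ k $ l = s j - s i" for i j
    using kl by (simp add: plucker_def g_def axis_def)
  then have "plucker (g i) (g j) \<noteq> 0" if "i \<noteq> j" for i j
    using that s by (metis eq_iff_diff_eq_0 inj_eq zero_index)
  then show ?thesis by blast
qed

lemma irreducible_in_generic_pictures:
  assumes n: "n \<ge> 3" and inf: "infinite (UNIV :: 'a::field set)" and m: "CARD('m::finite) \<ge> 2"
  shows "irreducible_in (picture_topology (cycle_graph n))
    (generic_pictures (cycle_graph n) :: (nat, 'a, 'm) picture set)"
proof (rule irreducible_in_cycI[OF n inf])
  obtain g :: "nat \<Rightarrow> 'a ^ 'm" where "\<And>i j. i \<noteq> j \<Longrightarrow> plucker (g i) (g j) \<noteq> 0"
    using pairwise_independent_family[OF inf m] by metis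
  then have "cyc_pic n g (\<lambda>i. g (cyc_succ n i)) \<in> generic_pictures (cycle_graph n)"
    using generic_pictures_cycle[OF n] by blast
  then show "generic_pictures (cycle_graph n) \<noteq> ({} :: (nat, 'a, 'm) picture set)"
    by blast
  show "generic_pictures (cycle_graph n) \<subseteq> (picture_space (cycle_graph n) :: (nat, 'a, 'm) picture set)"
    by (auto simp: generic_pictures_def)
next
  fix P Q :: "(nat, 'a, 'm) picture"
  assume "P \<in> generic_pictures (cycle_graph n)" "Q \<in> generic_pictures (cycle_graph n)"
  then obtain u w where u: "\<forall>i<n. \<forall>j<n. i \<noteq> j \<longrightarrow> plucker (u i) (u j) \<noteq> 0"
      "P = cyc_pic n u (\<lambda>i. u (cyc_succ n i))"
    and w: "\<forall>i<n. \<forall>j<n. i \<noteq> j \<longrightarrow> plucker (w i) (w j) \<noteq> 0"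
      "Q = cyc_pic n w (\<lambda>i. w (cyc_succ n i))"
    unfolding generic_pictures_cycle[OF n] by blast
  \<comment> \<open>The segment joining the two families of points; the lines follow as joins of
    consecutive points, and independence at \<open>t = 0\<close> persists for almost all
    \<open>t\<close>.\<close>
  define x where "x t i = (1 - t) *s u i + t *s w i" for t i
  define b where "b t i = x t (cyc_succ n i)" for t i
  have x0: "x 0 = u" "x 1 = w"
    by (simp_all add: x_def fun_eq_iff)
  have x: "\<forall>i. poly_vec (\<lambda>t. x t i)"
    unfolding x_def by (intro allI poly_vec_add poly_vec_scale poly_fun_diff) simp_all
  have b: "\<forall>i. poly_vec (\<lambda>t. b t i)"
    using x by (simp add: b_def)
  have "finite {t. \<not> (\<forall>i<n. \<forall>j<n. i \<noteq> j \<longrightarrow> plucker (x t i) (x t j) \<noteq> 0)}"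
    using finite_not_pairwise_independent[of x n 0] x u(1) x0 by simp
  moreover have "cyc_valid n (x t) (b t) \<and> cyc_pic n (x t) (b t) \<in> generic_pictures (cycle_graph n)"
    if "\<forall>i<n. \<forall>j<n. i \<noteq> j \<longrightarrow> plucker (x t i) (x t j) \<noteq> 0" for t
    using cyc_valid_generic[OF n that] cyc_pic_in_generic_pictures[OF n cyc_valid_generic[OF n that]] that
    unfolding b_def by metis
  ultimately have fin: "finite {t. \<not> (cyc_valid n (x t) (b t) \<and> cyc_pic n (x t) (b t) \<in> generic_pictures (cycle_graph n))}"
    by (elim rev_finite_subset) blast
  have v: "cyc_valid n (x 0) (b 0)" "cyc_valid n (x 1) (b 1)"
    using cyc_valid_generic[OF n u(1)] cyc_valid_generic[OF n w(1)] by (simp_all add: b_def[abs_def] x0)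
  show "\<exists>x b. (\<forall>i. poly_vec (\<lambda>t. x t i)) \<and> (\<forall>i. poly_vec (\<lambda>t. b t i)) \<and>
      cyc_valid n (x 0) (b 0) \<and> P = cyc_pic n (x 0) (b 0) \<and>
      cyc_valid n (x 1) (b 1) \<and> Q = cyc_pic n (x 1) (b 1) \<and>
      finite {t. \<not> (cyc_valid n (x t) (b t) \<and> cyc_pic n (x t) (b t) \<in> generic_pictures (cycle_graph n))}"
    using x b fin v u(2) w(2) by (intro exI[of _ x] exI[of _ b]) (simp add: x0 b_def[abs_def])
qed

lemma irreducible_in_indiscrete_cellule:
  assumes n: "n \<ge> 3" and inf: "infinite (UNIV :: 'a::field set)" and m: "CARD('m::finite) \<ge> 2"
  shows "irreducible_in (picture_topology (cycle_graph n))
    (indiscrete_cellule (cycle_graph n) :: (nat, 'a, 'm) picture set)"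
proof (rule irreducible_in_cycI[OF n inf])
  obtain g :: "nat \<Rightarrow> 'a ^ 'm" where "\<And>i j. i \<noteq> j \<Longrightarrow> plucker (g i) (g j) \<noteq> 0"
    using pairwise_independent_family[OF inf m] by metis
  then have "plucker (g 0) (g 1) \<noteq> 0"
    by simp
  then have "cyc_pic n (\<lambda>_. g 0) (\<lambda>_. g 1) \<in> indiscrete_cellule (cycle_graph n)"
    unfolding indiscrete_cellule_cycle[OF n]
    by (intro exI[of _ "g 0"] exI[of _ "\<lambda>_. g 1"] conjI allI impI refl)
  then show "indiscrete_cellule (cycle_graph n) \<noteq> ({} :: (nat, 'a, 'm) picture set)"
    by blast
  show "indiscrete_cellule (cycle_graph n) \<subseteq> (picture_space (cycle_graph n) :: (nat, 'a, 'm) picture set)"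
    by (auto simp: indiscrete_cellule_def)
next
  fix P Q :: "(nat, 'a, 'm) picture"
  assume "P \<in> indiscrete_cellule (cycle_graph n)" "Q \<in> indiscrete_cellule (cycle_graph n)"
  then obtain u c w d where u: "\<forall>i<n. plucker u (c i) \<noteq> 0" "P = cyc_pic n (\<lambda>_. u) c"
    and w: "\<forall>i<n. plucker w (d i) \<noteq> 0" "Q = cyc_pic n (\<lambda>_. w) d"
    unfolding indiscrete_cellule_cycle[OF n] by blast
  \<comment> \<open>Both the common point and the second spanning vectors move along segments. As
    \<open>x t i\<close> does not depend on \<open>i\<close>, all points stay equal and incidence is
    automatic.\<close>
  define x where "x t i = (1 - t) *s u + t *s w" for t and i :: nat
  define b where "b t i = (1 - t) *s c i + t *s d i" for t i
  have x0: "x 0 = (\<lambda>_. u)" "x 1 = (\<lambda>_. w)" "b 0 = c" "b 1 = d"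
    by (simp_all add: x_def b_def fun_eq_iff)
  have x: "\<forall>i. poly_vec (\<lambda>t. x t i)" "\<forall>i. poly_vec (\<lambda>t. b t i)"
    unfolding x_def b_def by (intro allI poly_vec_add poly_vec_scale poly_fun_diff; simp)+
  have incident: "x t (cyc_succ n i) \<in> vec.span {x t i, b t i}" for t i
    by (simp add: x_def vec.span_base)
  have "finite {t. \<not> cyc_valid n (x t) (b t)}"
    using x u(1) incident by (intro finite_not_cyc_valid[where s = 0]) (simp_all add: x0)
  moreover have "cyc_pic n (x t) (b t) \<in> indiscrete_cellule (cycle_graph n)"
    if "cyc_valid n (x t) (b t)" for t
    using that unfolding indiscrete_cellule_cycle[OF n] cyc_valid_def x_def by blast
  ultimately have fin: "finite {t. \<not> (cyc_valid n (x t) (b t) \<and> cyc_pic n (x t) (b t) \<in> indiscrete_cellule (cycle_graph n))}"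
    by (elim rev_finite_subset) blast
  have v: "cyc_valid n (x 0) (b 0)" "cyc_valid n (x 1) (b 1)"
    using u(1) w(1) incident by (simp_all add: cyc_valid_def x0 vec.span_base)
  show "\<exists>x b. (\<forall>i. poly_vec (\<lambda>t. x t i)) \<and> (\<forall>i. poly_vec (\<lambda>t. b t i)) \<and>
      cyc_valid n (x 0) (b 0) \<and> P = cyc_pic n (x 0) (b 0) \<and>
      cyc_valid n (x 1) (b 1) \<and> Q = cyc_pic n (x 1) (b 1) \<and>
      finite {t. \<not> (cyc_valid n (x t) (b t) \<and> cyc_pic n (x t) (b t) \<in> indiscrete_cellule (cycle_graph n))}"
    using x fin v u(2) w(2) by (intro exI[of _ x] exI[of _ b]) (simp add: x0)
qed

section \<open>Limits of generic pictures\<close>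

lemma closedin_picture_variety: "closedin (picture_topology G) (picture_variety G)"
  by (simp add: picture_variety_def)

lemma generic_subset_picture_variety:
  assumes "finite_simple_graph G"
  shows "generic_pictures G \<subseteq> picture_variety G"
  unfolding picture_variety_def
  by (rule closure_of_subset)
    (use topspace_picture_topology[OF assms] in \<open>auto simp: generic_pictures_def\<close>)

text \<open>The picture is the limit for \<open>t = 0\<close> of the generic pictures with points spanned by
  \<open>x i + t a i + t\<^sup>2 z i\<close>, where \<open>a (i + 1) = a i + w i\<close>: to first order, two coinciding
  consecutive points are separated along their line. The total of the \<open>w i\<close> has to vanish for the
  cycle to close up.\<close>

lemma cyc_pic_in_picture_variety:
  fixes x :: "nat \<Rightarrow> 'a::field ^ 'm::finite"
  assumes n: "n \<ge> 3" and inf: "infinite (UNIV :: 'a set)" and m: "CARD('m) \<ge> 2"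
    and v: "cyc_valid n x b" and w: "(\<Sum>i<n. w i) = 0"
    and eq: "\<And>i. i < n \<Longrightarrow> x (cyc_succ n i) = x i \<Longrightarrow> b i = w i"
    and neq: "\<And>i. i < n \<Longrightarrow> x (cyc_succ n i) \<noteq> x i \<Longrightarrow> b i = x (cyc_succ n i)"
  shows "cyc_pic n x b \<in> picture_variety (cycle_graph n)"
proof -
  let ?V = "picture_variety (cycle_graph n) :: (nat, 'a, 'm) picture set"
  obtain g :: "nat \<Rightarrow> 'a ^ 'm" where g: "\<forall>i j. i \<noteq> j \<longrightarrow> plucker (g i) (g j) \<noteq> 0"
    using pairwise_independent_family[OF inf m] by (elim exE)
  define a where "a i = (\<Sum>j<i. w j)" for i
  \<comment> \<open>Makes \<open>X 1\<close> the family \<open>g\<close>, so the points are pairwise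
    independent at \<open>t = 1\<close> and hence for almost all \<open>t\<close>.\<close>
  define z where "z i = g i - x i - a i" for i
  define X where "X t i = x i + t *s a i + (t * t) *s z i" for t i
  \<comment> \<open>Where \<open>x\<close> takes equal values, this is
    \<open>X t (cyc_succ n i) - X t i\<close> divided by \<open>t\<close>, with value
    \<open>w i\<close> at \<open>t = 0\<close>.\<close>
  define B where "B t i = (if x (cyc_succ n i) = x i then w i + t *s (z (cyc_succ n i) - z i)
    else X t (cyc_succ n i))" for t i
  \<comment> \<open>At the last edge the successor is 0 and \<open>a 0 = 0\<close>; this is where
    the zero total of \<open>w\<close> enters.\<close>
  have a: "a (cyc_succ n i) = a i + w i" if "i < n" for i
  proof (cases "i + 1 = n")
    case True
    then have "a i + w i = (\<Sum>i<n. w i)"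
      by (auto simp: a_def)
    then show ?thesis
      using True that w by (simp add: cyc_succ_cases a_def)
  qed (use that in \<open>simp add: cyc_succ_cases a_def\<close>)
  have X0: "X 0 = x" and X1: "X 1 = g"
    by (simp_all add: X_def z_def fun_eq_iff)
  have B0: "B 0 i = b i" if "i < n" for i
    using eq[OF that] neq[OF that] by (auto simp: B_def X0)
  have pX: "poly_vec (\<lambda>t. X t i)" for i
    unfolding X_def by (intro poly_vec_add poly_vec_scale poly_fun_mult) simp_all
  have pB: "poly_vec (\<lambda>t. B t i)" for i
    using pX unfolding B_def
    by (cases "x (cyc_succ n i) = x i") (simp_all add: poly_vec_add poly_vec_diff poly_vec_scale)
  have incident: "X t (cyc_succ n i) \<in> vec.span {X t i, B t i}" if "i < n" for t i
  proof (cases "x (cyc_succ n i) = x i")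
    case True
    then have "X t (cyc_succ n i) = X t i + t *s B t i"
      using a[OF that] by (simp add: X_def B_def vec_eq_iff algebra_simps)
    then show ?thesis
      by (simp add: vec.span_add vec.span_scale vec.span_base)
  qed (simp add: B_def vec.span_base)
  have fin1: "finite {t. \<not> cyc_valid n (X t) (B t)}"
  proof (rule finite_not_cyc_valid[where x = X and b = B and s = 0, OF pX pB _ incident])
    show "plucker (X 0 i) (B 0 i) \<noteq> 0" if "i < n" for i
      using v that by (simp add: X0 B0 cyc_valid_def)
  qed
  have fin2: "finite {t. \<not> (\<forall>i<n. \<forall>j<n. i \<noteq> j \<longrightarrow> plucker (X t i) (X t j) \<noteq> 0)}"
    by (rule finite_not_pairwise_independent[OF pX, of n 1]) (simp add: X1 g)
  have good: "cyc_pic n (X t) (B t) \<in> ?V"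
    if "cyc_valid n (X t) (B t)" "\<forall>i<n. \<forall>j<n. i \<noteq> j \<longrightarrow> plucker (X t i) (X t j) \<noteq> 0" for t
    using that cyc_pic_in_generic_pictures[OF n that(1)]
      generic_subset_picture_variety[OF finite_simple_graph_cycle[OF n]] by blast
  have "finite {t. \<not> (cyc_valid n (X t) (B t) \<and> cyc_pic n (X t) (B t) \<in> ?V)}"
    by (rule rev_finite_subset[OF finite_UnI[OF fin1 fin2]]) (use good in blast)
  then have "infinite {t. cyc_valid n (X t) (B t) \<and> cyc_pic n (X t) (B t) \<in> ?V}"
    by (rule infinite_if_cofinite[OF inf])
  moreover have "cyc_valid n (X 0) (B 0)"
    using v by (simp add: cyc_valid_def X0 B0)
  ultimately have "cyc_pic n (X 0) (B 0) \<in> ?V"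
    by (rule cyc_curve_closed[OF n closedin_picture_variety pX pB])
  moreover have "cyc_pic n (X 0) (B 0) = cyc_pic n x b"
    by (rule cyc_pic_cong[OF n]) (simp_all add: X0 B0)
  ultimately show ?thesis by simp
qed

text \<open>If all consecutive representing vectors agreed, induction along the cycle would make the
  picture indiscrete. At an edge \<open>k\<close> where they differ, \<open>w k\<close> is
  unrestricted and can be chosen to make the total 0.\<close>

lemma not_indiscrete_in_picture_variety:
  fixes P :: "(nat, 'a::field, 'm::finite) picture"
  assumes n: "n \<ge> 3" and inf: "infinite (UNIV :: 'a set)" and m: "CARD('m) \<ge> 2"
    and P: "P \<in> picture_space (cycle_graph n)" "P \<notin> indiscrete_cellule (cycle_graph n)"
  shows "P \<in> picture_variety (cycle_graph n)"
proof -
  obtain p l where pl: "P = (p, l)" by fastforce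
  obtain x b where v: "cyc_valid n x b" "P = cyc_pic n x b"
    and b: "\<And>i. i < n \<Longrightarrow> x (cyc_succ n i) \<noteq> x i \<Longrightarrow> b i = x (cyc_succ n i)"
    using cyc_pic_exhaust[OF n P(1)[unfolded pl]] unfolding pl by metis
  have "\<exists>k<n. x (cyc_succ n k) \<noteq> x k"
  proof (rule ccontr)
    assume "\<not> (\<exists>k<n. x (cyc_succ n k) \<noteq> x k)"
    then have succ: "x (cyc_succ n i) = x i" if "i < n" for i
      using that by blast
    have x0: "x i = x 0" if "i < n" for i
      using that
    proof (induction i)
      case (Suc i)
      then show ?case
        using succ[of i] by (simp add: cyc_succ_cases)
    qed simp
    have "P = cyc_pic n (\<lambda>_. x 0) b"
      unfolding v(2) by (rule cyc_pic_cong[OF n]; subst x0; simp)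
    moreover have "\<forall>i<n. plucker (x 0) (b i) \<noteq> 0"
      using v(1) x0 unfolding cyc_valid_def by metis
    ultimately have "P \<in> indiscrete_cellule (cycle_graph n)"
      unfolding indiscrete_cellule_cycle[OF n] by (intro exI conjI)
    with P(2) show False ..
  qed
  then obtain k where k: "k < n" "x (cyc_succ n k) \<noteq> x k" by blast
  define w where "w = b(k := - (\<Sum>i\<in>{..<n} - {k}. b i))"
  have "(\<Sum>i<n. w i) = w k + (\<Sum>i\<in>{..<n} - {k}. w i)"
    using k(1) by (simp add: sum.remove)
  also have "(\<Sum>i\<in>{..<n} - {k}. w i) = (\<Sum>i\<in>{..<n} - {k}. b i)"
    by (rule sum.cong) (auto simp: w_def)
  finally have w: "(\<Sum>i<n. w i) = 0"
    by (simp add: w_def)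
  show ?thesis
    unfolding v(2) by (rule cyc_pic_in_picture_variety[OF n inf m v(1) w _ b]) (use k in \<open>auto simp: w_def\<close>)
qed

section \<open>Linear relations and change of spanning vectors\<close>

lemma dependent_family:
  fixes w :: "nat \<Rightarrow> 'a::field ^ 'm::finite"
  assumes "CARD('m) < n"
  obtains c where "\<exists>i<n. c i \<noteq> 0" "(\<Sum>i<n. c i *s w i) = 0"
proof (cases "inj_on w {..<n}")
  case True
  have "vec.dependent (w ` {..<n})"
  proof (rule ccontr)
    assume "vec.independent (w ` {..<n})"
    then have "card (w ` {..<n}) \<le> CARD('m)"
      using vec.independent_card_le_dim[of "w ` {..<n}" UNIV] by (simp add: vec.dim_UNIV card_cart_basis)
    with True assms show False
      by (simp add: card_image)
  qed
  then obtain u where u: "\<exists>v\<in>w ` {..<n}. u v \<noteq> 0" "(\<Sum>v\<in>w ` {..<n}. u v *s v) = 0"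
    using vec.dependent_finite[of "w ` {..<n}"] by auto
  show ?thesis
    by (rule that[of "\<lambda>i. u (w i)"]) (use u True in \<open>auto simp: sum.reindex\<close>)
next
  case False
  then obtain i j where ij: "i < n" "j < n" "i \<noteq> j" "w i = w j"
    by (auto simp: inj_on_def)
  \<comment> \<open>A repeated vector gives the relation \<open>w i - w j = 0\<close>, which the set
    of values does not show.\<close>
  define c :: "nat \<Rightarrow> 'a" where "c k = (if k = i then 1 else 0) - (if k = j then 1 else 0)" for k
  have "c k *s w k = (if k = i then w i else 0) - (if k = j then w j else 0)" for k
    by (simp add: c_def)
  then have "(\<Sum>k<n. c k *s w k) = 0"
    using ij by (simp add: sum_subtractf)
  moreover have "c i \<noteq> 0"
    using ij by (simp add: c_def)
  ultimately show ?thesis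
    using that ij(1) by blast
qed

lemma plucker_scale_shift: "plucker u (c *s w + d *s u) = (\<chi> i j. c * plucker u w $ i $ j)"
  using plucker_lincomb[of 1 u 0 w d c] by (simp add: add.commute)

lemma plucker_scale_shift_eq_0_iff:
  assumes "c \<noteq> (0 :: 'a::field)"
  shows "plucker u (c *s w + d *s u) = 0 \<longleftrightarrow> plucker u (w :: 'a ^ 'm::finite) = 0"
  using assms unfolding plucker_scale_shift by (simp add: vec_eq_iff)

lemma span_pair_scale_shift:
  assumes "c \<noteq> (0 :: 'a::field)"
  shows "vec.span {u, c *s w + d *s u} = vec.span {u, w :: 'a ^ 'm::finite}"
proof -
  let ?w = "c *s w + d *s u"
  have "w = inverse c *s (?w - d *s u)"
    using assms by simp
  also have "\<dots> \<in> vec.span {u, ?w}"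
    by (intro vec.span_scale vec.span_diff) (simp_all add: vec.span_base)
  finally have "w \<in> vec.span {u, ?w}" .
  moreover have "?w \<in> vec.span {u, w}"
    by (intro vec.span_add vec.span_scale) (simp_all add: vec.span_base)
  ultimately show ?thesis
    by (simp add: vec.span_eq vec.span_base)
qed

text \<open>For \<open>n \<ge> CARD('m)\<close> the \<open>b i\<close> are linearly dependent modulo \<open>u\<close>. A relation with all
  coefficients nonzero rescales the \<open>b i\<close> to total 0; the zero coefficients are replaced by \<open>t\<close>,
  at the cost of moving one of the \<open>b i\<close>.\<close>

lemma indiscrete_in_picture_variety:
  fixes P :: "(nat, 'a::field, 'm::finite) picture"
  assumes n: "n \<ge> 3" and inf: "infinite (UNIV :: 'a set)" and m: "CARD('m) \<ge> 2" "CARD('m) \<le> n"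
    and P: "P \<in> indiscrete_cellule (cycle_graph n)"
  shows "P \<in> picture_variety (cycle_graph n)"
proof -
  let ?V = "picture_variety (cycle_graph n) :: (nat, 'a, 'm) picture set"
  obtain u b where ub: "\<forall>i<n. plucker u (b i) \<noteq> 0" "P = cyc_pic n (\<lambda>_. u) b"
    using P unfolding indiscrete_cellule_cycle[OF n] by (elim exE conjE)
  have u0: "u \<noteq> 0"
    using ub(1)[rule_format, of 0] n by (simp add: plucker_eq_0_iff)
  \<comment> \<open>Appending \<open>u\<close> as vector number \<open>n\<close> gives
    \<open>n + 1\<close> vectors, more than the dimension \<open>CARD('m)\<close>; their relation is
    one among the \<open>b i\<close> modulo \<open>u\<close>.\<close>
  obtain c where c: "\<exists>i<Suc n. c i \<noteq> 0" "(\<Sum>i<Suc n. c i *s (b(n := u)) i) = 0"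
    using dependent_family[of "Suc n" "b(n := u)"] m(2) by auto
  have sum_b: "(\<Sum>i<n. c i *s b i) + c n *s u = 0"
    using c(2) by simp
  \<comment> \<open>As \<open>u\<close> is nonzero, there is no nontrivial relation involving
    \<open>u\<close> alone.\<close>
  have "\<exists>k<n. c k \<noteq> 0"
  proof (rule ccontr)
    assume *: "\<not> (\<exists>k<n. c k \<noteq> 0)"
    then have "c n *s u = 0"
      using sum_b by simp
    with * c(1) u0 show False
      by (auto simp: less_Suc_eq)
  qed
  then obtain k where k: "k < n" "c k \<noteq> 0" by blast
  define s where "s = (\<Sum>i<n. if c i = 0 then b i else 0)"
  \<comment> \<open>Dividing by \<open>c k\<close> lets the term \<open>c k *s B t k\<close> absorb
    exactly \<open>t *s s\<close>.\<close>
  define B where "B t i = (if i = k then b i - (t / c k) *s s else b i)" for t i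
  \<comment> \<open>The zero coefficients become \<open>t\<close>. The correction at
    \<open>k\<close> cancels the resulting \<open>t *s s\<close> and supplies the multiple of
    \<open>u\<close> from the relation, so the total is 0.\<close>
  define w where "w t i = c i *s b i + (if c i = 0 then t *s b i else 0) +
    (if i = k then c n *s u - t *s s else 0)" for t i
  have pB: "poly_vec (\<lambda>t. B t i)" for i
    unfolding B_def
    by (cases "i = k") (simp_all add: poly_vec_diff poly_vec_scale divide_inverse poly_fun_mult)
  have B0: "B 0 = b"
    by (simp add: B_def fun_eq_iff)
  have w_sum: "(\<Sum>i<n. w t i) = 0" for t
  proof -
    have "(\<Sum>i<n. if c i = 0 then t *s b i else 0) = t *s s"
      unfolding s_def vec.scale_sum_right by (intro sum.cong) simp_all
    then have "(\<Sum>i<n. w t i) = (\<Sum>i<n. c i *s b i) + t *s s + (c n *s u - t *s s)"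
      using k(1) by (simp add: w_def sum.distrib)
    with sum_b show ?thesis by (simp add: algebra_simps)
  qed
  \<comment> \<open>The value \<open>t = 0\<close> is excluded because \<open>t\<close> is the
    scaling factor where \<open>c i\<close> vanishes.\<close>
  have wB: "\<exists>\<kappa> \<mu>. \<kappa> \<noteq> 0 \<and> w t i = \<kappa> *s B t i + \<mu> *s u" if "t \<noteq> 0" for t i
  proof -
    consider "i = k" | "i \<noteq> k" "c i = 0" | "i \<noteq> k" "c i \<noteq> 0" by blast
    then show ?thesis
    proof cases
      case 1
      then have "w t i = c k *s B t i + c n *s u"
        using k(2) by (simp add: w_def B_def vec_eq_iff algebra_simps)
      with k(2) show ?thesis by blast
    next
      case 2
      then have "w t i = t *s B t i + 0 *s u"
        by (simp add: w_def B_def)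
      with that show ?thesis by blast
    next
      case 3
      then have "w t i = c i *s B t i + 0 *s u"
        by (simp add: w_def B_def)
      with 3 show ?thesis by blast
    qed
  qed
  have u_span: "u \<in> vec.span {u, v}" for v
    by (simp add: vec.span_base)
  have good: "cyc_pic n (\<lambda>_. u) (B t) \<in> ?V" if "t \<noteq> 0" and v: "cyc_valid n (\<lambda>_. u) (B t)" for t
  proof -
    have "plucker u (w t i) \<noteq> 0" if "i < n" for i
      using wB[OF \<open>t \<noteq> 0\<close>, of i] v that plucker_scale_shift_eq_0_iff unfolding cyc_valid_def by metis
    then have "cyc_valid n (\<lambda>_. u) (w t)"
      by (simp add: cyc_valid_def u_span)
    then have "cyc_pic n (\<lambda>_. u) (w t) \<in> ?V"
      by (rule cyc_pic_in_picture_variety[OF n inf m(1) _ w_sum]) simp_all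
    moreover have "cyc_pic n (\<lambda>_. u) (w t) = cyc_pic n (\<lambda>_. u) (B t)"
    proof (rule cyc_pic_cong[OF n])
      show "vec.span {u, w t i} = vec.span {u, B t i}" for i
        using wB[OF \<open>t \<noteq> 0\<close>, of i] span_pair_scale_shift by metis
    qed simp
    ultimately show ?thesis by simp
  qed
  have "finite {t. \<not> cyc_valid n (\<lambda>_. u) (B t)}"
  proof (rule finite_not_cyc_valid[where x = "\<lambda>_ _. u", OF _ pB])
    show "plucker u (B 0 i) \<noteq> 0" if "i < n" for i
      using ub(1) that by (simp add: B0)
  qed (simp_all add: u_span)
  then have "finite ({t. \<not> cyc_valid n (\<lambda>_. u) (B t)} \<union> {0})"
    by simp
  then have "finite {t. \<not> (cyc_valid n (\<lambda>_. u) (B t) \<and> cyc_pic n (\<lambda>_. u) (B t) \<in> ?V)}"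
    by (rule rev_finite_subset) (use good in blast)
  then have "infinite {t. cyc_valid n (\<lambda>_. u) (B t) \<and> cyc_pic n (\<lambda>_. u) (B t) \<in> ?V}"
    by (rule infinite_if_cofinite[OF inf])
  moreover have "cyc_valid n (\<lambda>_. u) (B 0)"
    using ub(1) by (simp add: B0 cyc_valid_def u_span)
  ultimately have "cyc_pic n (\<lambda>_. u) (B 0) \<in> ?V"
    by (rule cyc_curve_closed[where x = "\<lambda>_ _. u", OF n closedin_picture_variety poly_vec_const pB])
  then show ?thesis
    by (simp add: B0 ub(2))
qed

section \<open>Equations for the two components\<close>

lemma multihomogeneous_prod:
  assumes "finite I" "\<And>i. i \<in> I \<Longrightarrow> multihomogeneous G (m i) (k i) (f i)"
  shows "multihomogeneous G (\<lambda>v. \<Sum>i\<in>I. m i v) (\<lambda>e. \<Sum>i\<in>I. k i e) (\<lambda>x y. \<Prod>i\<in>I. f i x y)"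
  using assms
proof (induction rule: finite_induct)
  case empty
  show ?case using multihomogeneous.const[of G 1] by simp
next
  case (insert i I)
  have "multihomogeneous G (\<lambda>v. m i v + (\<Sum>i\<in>I. m i v)) (\<lambda>e. k i e + (\<Sum>i\<in>I. k i e))
      (\<lambda>x y. f i x y * (\<Prod>i\<in>I. f i x y))"
    by (rule multihomogeneous.mult) (use insert in simp_all)
  with insert(1,2) show ?case by simp
qed

text \<open>The empty sum is excluded because the generating rules cannot give the zero function a
  positive degree in a vertex outside \<open>G\<close>.\<close>

lemma multihomogeneous_sum:
  assumes "finite I" "I \<noteq> {}" "\<And>i. i \<in> I \<Longrightarrow> multihomogeneous G m k (f i)"
  shows "multihomogeneous G m k (\<lambda>x y. \<Sum>i\<in>I. f i x y)"
  using assms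
proof (induction rule: finite_ne_induct)
  case (insert i I)
  have "multihomogeneous G m k (\<lambda>x y. f i x y + (\<Sum>i\<in>I. f i x y))"
    by (rule multihomogeneous.add) (use insert in simp_all)
  with insert(1,3) show ?case by simp
qed simp

lemma multihomogeneous_cmult:
  "multihomogeneous G m k f \<Longrightarrow> multihomogeneous G m k (\<lambda>x y. c * f x y)"
  using multihomogeneous.mult[OF multihomogeneous.const] by fastforce

text \<open>Each term of the Leibniz expansion takes one entry from every row. As the degrees depend
  on the row only, all terms have the same multidegree.\<close>

lemma multihomogeneous_det:
  fixes A :: "_ \<Rightarrow> _ \<Rightarrow> 'a::field ^ 'm::finite ^ 'm"
  assumes "\<And>r c. multihomogeneous G (m r) (k r) (\<lambda>x y. A x y $ r $ c)"
  shows "multihomogeneous G (\<lambda>v. \<Sum>r\<in>UNIV. m r v) (\<lambda>e. \<Sum>r\<in>UNIV. k r e) (\<lambda>x y. det (A x y))"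
  unfolding det_def
proof (rule multihomogeneous_sum)
  have "id \<in> {p :: 'm \<Rightarrow> 'm. p permutes UNIV}"
    by (simp add: permutes_id)
  then show "{p :: 'm \<Rightarrow> 'm. p permutes UNIV} \<noteq> {}"
    by blast
  show "multihomogeneous G (\<lambda>v. \<Sum>r\<in>UNIV. m r v) (\<lambda>e. \<Sum>r\<in>UNIV. k r e)
      (\<lambda>x y. of_int (sign p) * (\<Prod>r\<in>UNIV. A x y $ r $ p r))" for p
    by (intro multihomogeneous_cmult multihomogeneous_prod assms) simp
qed simp

lemma closedin_picture_topologyI:
  assumes "finite_simple_graph G" "S \<subseteq> multihom_polys G"
  shows "closedin (picture_topology G) (zero_locus G S \<inter> picture_space G)"
  unfolding picture_topology_def closedin_subtopology
  by (intro exI[of _ "zero_locus G S"] conjI refl)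
    (use assms closedin_zariski[OF assms(1)] in blast)

text \<open>The equations are the 2 by 2 minors of the representing vectors of any two
  vertices.\<close>

lemma closedin_indiscrete_cellule:
  assumes n: "n \<ge> 3"
  shows "closedin (picture_topology (cycle_graph n))
    (indiscrete_cellule (cycle_graph n) :: (nat, 'a::field, 'm::finite) picture set)"
proof -
  let ?G = "cycle_graph n"
  let ?f = "\<lambda>v w i j (x :: nat \<Rightarrow> 'a ^ 'm) (y :: nat set \<Rightarrow> 'a ^ 'm ^ 'm).
    x v $ i * x w $ j + (- 1) * (x v $ j * x w $ i)"
  let ?S = "(\<lambda>(v, w, i, j). ?f v w i j) ` ({..<n} \<times> {..<n} \<times> UNIV)"
  have mh: "multihomogeneous ?G (\<lambda>u. (if u = v then 1 else 0) + (if u = w then 1 else 0))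
      (\<lambda>e. 0 + 0) (?f v w i j)" if "v < n" "w < n" for v w i j
    by (intro multihomogeneous.add multihomogeneous_cmult multihomogeneous.mult
        multihomogeneous.point_coord) (use that in \<open>simp_all add: verts_cycle\<close>)
  have S: "?S \<subseteq> multihom_polys ?G"
  proof
    fix f assume "f \<in> ?S"
    then obtain v w i j where f: "f = ?f v w i j" and vw: "v < n" "w < n" by auto
    show "f \<in> multihom_polys ?G"
      unfolding multihom_polys_def mem_Collect_eq f by (intro exI) (rule mh[OF vw])
  qed
  have "P \<in> indiscrete_cellule ?G \<longleftrightarrow> P \<in> zero_locus ?G ?S"
    if P: "P \<in> picture_space ?G" for P :: "(nat, 'a, 'm) picture"
  proof -
    obtain p l where pl: "P = (p, l)" by fastforce
    obtain x b where v: "cyc_valid n x b" "P = cyc_pic n x b"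
      using cyc_pic_exhaust[OF n P[unfolded pl]] unfolding pl by metis
    have "P \<in> indiscrete_cellule ?G \<longleftrightarrow> (\<forall>v<n. \<forall>w<n. vec.span {x v} = vec.span {x w})"
      using cyc_pic_in_picture_space[OF n v(1)] unfolding v(2)
      by (simp add: indiscrete_cellule_def cyc_pic_def verts_cycle Ball_def)
    also have "\<dots> \<longleftrightarrow> (\<forall>v<n. \<forall>w<n. plucker (x v) (x w) = 0)"
      using span_eq_span_singleton_iff cyc_valid_nonzero[OF v(1)] by metis
    also have "\<dots> \<longleftrightarrow> (\<forall>v<n. \<forall>w<n. \<forall>i j. ?f v w i j x (cyc_plucker n x b) = 0)"
      by (simp add: plucker_def vec_eq_iff)
    also have "\<dots> \<longleftrightarrow> (\<forall>f\<in>?S. f x (cyc_plucker n x b) = 0)"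
      unfolding ball_simps(9) by auto
    also have "\<dots> \<longleftrightarrow> P \<in> zero_locus ?G ?S"
      unfolding v(2) by (rule cyc_pic_in_zero_locus[OF n v(1) S, symmetric])
    finally show ?thesis .
  qed
  then have "indiscrete_cellule ?G = zero_locus ?G ?S \<inter> (picture_space ?G :: (nat, 'a, 'm) picture set)"
    unfolding indiscrete_cellule_def by blast
  then show ?thesis
    using closedin_picture_topologyI[OF finite_simple_graph_cycle[OF n] S] by simp
qed

section \<open>A determinantal equation satisfied by generic pictures\<close>

lemma det_eq_0_if_kernel:
  fixes A :: "'a::field ^ 'm::finite ^ 'm"
  assumes "A *v c = 0" "c \<noteq> 0"
  shows "det A = 0"
proof (rule ccontr)
  assume "det A \<noteq> 0"
  then have "\<exists>B. B ** A = mat 1"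
    by (auto simp: invertible_det_nz[symmetric] invertible_def)
  with assms show False
    unfolding matrix_left_invertible_ker by blast
qed

text \<open>The successor map permutes the vertices: \<open>h 0\<close> moves from the front to the
  end. Differences around the cycle therefore add up to 0.\<close>

lemma sum_cyc_succ: "n \<ge> 1 \<Longrightarrow> (\<Sum>i<n. h (cyc_succ n i)) = (\<Sum>i<n. h i)"
proof -
  assume "n \<ge> 1"
  then obtain k where n: "n = Suc k"
    by (cases n) auto
  have "(\<Sum>i<k. h (cyc_succ n i)) = (\<Sum>i<k. h (Suc i))"
    by (rule sum.cong) (simp_all add: cyc_succ_def n)
  then have "(\<Sum>i<n. h (cyc_succ n i)) = (\<Sum>i<k. h (Suc i)) + h 0"
    unfolding n by (simp add: cyc_succ_def)
  then show ?thesis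
    unfolding n by (simp only: sum.lessThan_Suc_shift add.commute)
qed

text \<open>The rows with index \<open>z\<close> of the Pluecker matrices of the lines of a generic picture
  are multiples of the differences of consecutive points in the affine chart where the coordinate
  \<open>z\<close> is 1. Around the cycle these differences add up to 0, so that a determinant vanishes; it
  does not for lines in general position through a common point.\<close>

lemma indiscrete_not_subset_picture_variety:
  assumes n: "n \<ge> 3" and m: "n < CARD('m::finite)"
  shows "\<not> indiscrete_cellule (cycle_graph n) \<subseteq>
    (picture_variety (cycle_graph n) :: (nat, 'a::field, 'm) picture set)"
proof -
  let ?G = "cycle_graph n"
  note G = finite_simple_graph_cycle[OF n]
  obtain z :: 'm where True by simp
  \<comment> \<open>There are enough coordinates other than \<open>z\<close> to reserve one matrix
    row for each of the \<open>n\<close> lines.\<close>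
  have "card (UNIV - {z}) \<ge> n"
    using m by simp
  then obtain M where M: "M \<subseteq> UNIV - {z}" "card M = n"
    by (meson obtain_subset_with_card_n)
  obtain q where bij: "bij_betw q M {..<n}"
    using ex_bij_betw_finite_nat[of M] M(2) by (auto simp: atLeast0LessThan)
  define j where "j = inv_into M q"
  have j: "j i \<in> M \<and> q (j i) = i" if "i < n" for i
    using that bij_betwE[OF bij_betw_inv_into[OF bij]] bij_betw_inv_into_right[OF bij]
    by (simp add: j_def)
  have q: "q r < n \<and> j (q r) = r" if "r \<in> M" for r
    using that bij_betwE[OF bij] bij_betw_inv_into_left[OF bij] by (simp add: j_def)
  have sum_M: "(\<Sum>r\<in>M. h r) = (\<Sum>i<n. h (j i))" for h :: "'m \<Rightarrow> 'a"
    by (rule sum.reindex_bij_witness[of _ j q]) (use j q in auto)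
  \<comment> \<open>The rows outside \<open>M\<close> are those of the identity and fill the matrix
    up to a square one.\<close>
  define A :: "(nat \<Rightarrow> 'a ^ 'm) \<Rightarrow> (nat set \<Rightarrow> 'a ^ 'm ^ 'm) \<Rightarrow> 'a ^ 'm ^ 'm" where
    "A x y = (\<chi> r c. if r \<in> M then y (cyc_edge n (q r)) $ z $ c else if r = c then 1 else 0)" for x y
  \<comment> \<open>The product makes \<open>f\<close> vanish also if some point lies outside the
    chart.\<close>
  define f where "f x y = (\<Prod>i<n. x i $ z) * det (A x y)" for x y
  have "multihomogeneous ?G (\<lambda>_. 0) (\<lambda>e. if r \<in> M \<and> e = cyc_edge n (q r) then 1 else 0)
      (\<lambda>x y. A x y $ r $ c)" for r c
  proof (cases "r \<in> M")
    case True
    then have "cyc_edge n (q r) \<in> edges ?G"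
      using q by (simp add: edges_cycle)
    from multihomogeneous.line_coord[OF this, of z c] True show ?thesis
      by (simp add: A_def)
  next
    case False
    then show ?thesis
      using multihomogeneous.const[of ?G "if r = c then 1 else 0"] by (simp add: A_def)
  qed
  from multihomogeneous_det[of ?G, OF this]
  have "(\<lambda>x y. det (A x y)) \<in> multihom_polys ?G"
    unfolding multihom_polys_def by blast
  moreover have "(\<lambda>x y. \<Prod>i<n. x i $ z) \<in> multihom_polys ?G"
    unfolding multihom_polys_def mem_Collect_eq
    by (intro exI) (rule multihomogeneous_prod[OF finite_lessThan multihomogeneous.point_coord],
      simp add: verts_cycle)
  ultimately have f: "f \<in> multihom_polys ?G"
    unfolding f_def[abs_def] by (rule multihom_polys_mult[rotated])
  have vanish: "P \<in> zero_locus ?G {f}" if P: "P \<in> generic_pictures ?G" for P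
  proof -
    obtain x where x: "\<forall>i<n. \<forall>j<n. i \<noteq> j \<longrightarrow> plucker (x i) (x j) \<noteq> 0"
      and Px: "P = cyc_pic n x (\<lambda>i. x (cyc_succ n i))"
      using P unfolding generic_pictures_cycle[OF n] by (elim exE conjE)
    let ?y = "cyc_plucker n x (\<lambda>i. x (cyc_succ n i))"
    have "f x ?y = 0"
    proof (cases "\<exists>i<n. x i $ z = 0")
      case False
      then have nz: "x i $ z \<noteq> 0" if "i < n" for i
        using that by blast
      \<comment> \<open>A kernel vector of the transpose: these factors turn the Pluecker entries
        into differences of affine coordinates, and the rows outside \<open>M\<close> get
        coefficient 0.\<close>
      define a :: "'a ^ 'm" where
        "a = (\<chi> r. if r \<in> M then 1 / (x (q r) $ z * x (cyc_succ n (q r)) $ z) else 0)"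
      have "(transpose (A x ?y) *v a) $ c = 0" for c
      proof -
        let ?h = "\<lambda>i. x i $ c / x i $ z"
        have "(transpose (A x ?y) *v a) $ c = (\<Sum>r\<in>UNIV. A x ?y $ r $ c * a $ r)"
          by (simp add: matrix_vector_mult_def transpose_def)
        also have "\<dots> = (\<Sum>r\<in>M. A x ?y $ r $ c * a $ r)"
          by (rule sum.mono_neutral_right) (auto simp: a_def)
        also have "\<dots> = (\<Sum>i<n. A x ?y $ j i $ c * a $ j i)"
          by (rule sum_M)
        also have "\<dots> = (\<Sum>i<n. ?h (cyc_succ n i) - ?h i)"
        proof (rule sum.cong[OF refl])
          fix i assume "i \<in> {..<n}"
          then have i: "i < n" by simp
          show "A x ?y $ j i $ c * a $ j i = ?h (cyc_succ n i) - ?h i"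
            using j[OF i] nz[OF i] nz[OF cyc_succ_less[OF i]] n i
            by (simp add: A_def a_def cyc_plucker_def cyc_index_edge plucker_def field_simps)
        qed
        also have "\<dots> = 0"
          using sum_cyc_succ[of n ?h] n by (simp add: sum_subtractf)
        finally show ?thesis .
      qed
      then have "transpose (A x ?y) *v a = 0"
        by (simp add: vec_eq_iff)
      moreover have "a $ j 0 \<noteq> 0"
        using j[of 0] nz[of 0] nz[OF cyc_succ_less[of 0 n]] n by (simp add: a_def)
      then have "a \<noteq> 0" by auto
      ultimately have "det (transpose (A x ?y)) = 0"
        by (rule det_eq_0_if_kernel)
      then show ?thesis by (simp add: f_def)
    qed (auto simp: f_def)
    then show ?thesis
      unfolding Px using cyc_pic_in_zero_locus[OF n cyc_valid_generic[OF n x], of "{f}"] f by simp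
  qed
  have V: "picture_variety ?G \<subseteq> zero_locus ?G {f} \<inter> picture_space ?G"
    unfolding picture_variety_def
  proof (rule closure_of_minimal)
    show "closedin (picture_topology ?G) (zero_locus ?G {f} \<inter> picture_space ?G)"
      using f by (intro closedin_picture_topologyI[OF G]) simp
    show "generic_pictures ?G \<subseteq> zero_locus ?G {f} \<inter> picture_space ?G"
      using vanish by (auto simp: generic_pictures_def)
  qed
  \<comment> \<open>A common coordinate point with lines towards \<open>n\<close> other ones: row
    \<open>z\<close> of the \<open>i\<close>-th Pluecker matrix is the unit vector at
    \<open>j i\<close>, so \<open>A\<close> becomes the identity.\<close>
  define u :: "nat \<Rightarrow> 'a ^ 'm" where "u = (\<lambda>_. axis z 1)"
  define b :: "nat \<Rightarrow> 'a ^ 'm" where "b i = axis (j i) 1" for i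
  have entry: "plucker (u i) (b i) $ z $ c = (if c = j i then 1 else 0)" if "i < n" for i c
    using j[OF that] M(1) by (auto simp: plucker_def u_def b_def axis_def)
  have indep: "plucker (u i) (b i) \<noteq> 0" if "i < n" for i
    using entry[OF that, of "j i"] by (metis one_neq_zero zero_index)
  then have v: "cyc_valid n u b"
    by (simp add: cyc_valid_def u_def vec.span_base)
  have I: "cyc_pic n u b \<in> indiscrete_cellule ?G"
    unfolding indiscrete_cellule_cycle[OF n]
    using indep by (intro exI[of _ "axis z 1"] exI[of _ b]) (simp add: u_def)
  have "A u (cyc_plucker n u b) = mat 1"
    using entry q n by (auto simp: A_def mat_def vec_eq_iff cyc_plucker_def cyc_index_edge)
  then have "f u (cyc_plucker n u b) = 1"
    by (simp add: f_def u_def)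
  then have "cyc_pic n u b \<notin> zero_locus ?G {f}"
    using cyc_pic_in_zero_locus[OF n v, of "{f}"] f by simp
  with V I show ?thesis by blast
qed

theorem corollary2p6:
  fixes d n :: nat
    and X :: "(nat, 'a::alg_closed_field, 'm::finite) picture topology"
  assumes "CARD('m) = d + 1" and "d \<ge> 3" and "n \<ge> 3"
    and "X = picture_topology (cycle_graph n)"
  shows "(d < n \<longrightarrow> irreducible_in X (picture_space (cycle_graph n))) \<and>
    (d \<ge> n \<longrightarrow>
      irreducible_components X =
        {picture_variety (cycle_graph n), indiscrete_cellule (cycle_graph n)} \<and>
      picture_variety (cycle_graph n) \<noteq>
        (indiscrete_cellule (cycle_graph n) :: (nat, 'a, 'm) picture set))"
proof -
  note n = \<open>n \<ge> 3\<close> and inf = infinite_alg_closed_field[where 'a = 'a]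
  have m: "CARD('m) \<ge> 2"
    using assms(1,2) by simp
  define V where "V = (picture_variety (cycle_graph n) :: (nat, 'a, 'm) picture set)"
  define I where "I = (indiscrete_cellule (cycle_graph n) :: (nat, 'a, 'm) picture set)"
  let ?S = "picture_space (cycle_graph n) :: (nat, 'a, 'm) picture set"
  have top: "topspace X = ?S"
    unfolding assms(4) by (rule topspace_picture_topology[OF finite_simple_graph_cycle[OF n]])
  have V_closed: "closedin X V" and I_closed: "closedin X I"
    unfolding assms(4) V_def I_def
    by (rule closedin_picture_variety, rule closedin_indiscrete_cellule[OF n])
  have V_irr: "irreducible_in X V"
    unfolding assms(4) V_def picture_variety_def
    by (rule irreducible_in_closure_of[OF irreducible_in_generic_pictures[OF n inf m]])
  have I_irr: "irreducible_in X I"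
    unfolding assms(4) I_def by (rule irreducible_in_indiscrete_cellule[OF n inf m])
  have cover: "?S \<subseteq> V \<union> I"
    using not_indiscrete_in_picture_variety[OF n inf m] unfolding V_def I_def by blast
  have "irreducible_in X ?S" if "d < n"
  proof -
    \<comment> \<open>Here \<open>d < n\<close> means \<open>CARD('m) \<le> n\<close>, so that the
      lines through the common point are dependent modulo it.\<close>
    have "I \<subseteq> V"
      using indiscrete_in_picture_variety[OF n inf m] that assms(1) unfolding V_def I_def by auto
    then have "V = ?S"
      using cover closedin_subset[OF V_closed] top by blast
    with V_irr show ?thesis by simp
  qed
  moreover have "irreducible_components X = {V, I} \<and> V \<noteq> I" if "d \<ge> n"
  proof -
    have IV: "\<not> I \<subseteq> V"
      using indiscrete_not_subset_picture_variety[OF n, where 'm = 'm and 'a = 'a] that assms(1)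
      unfolding V_def I_def by simp
    \<comment> \<open>A generic picture has different points at the vertices 0 and 1, so it is not
      indiscrete.\<close>
    have VI: "\<not> V \<subseteq> I"
    proof
      assume "V \<subseteq> I"
      then have sub: "generic_pictures (cycle_graph n) \<subseteq> I"
        using generic_subset_picture_variety[OF finite_simple_graph_cycle[OF n]]
        unfolding V_def by blast
      obtain P :: "(nat, 'a, 'm) picture" where P: "P \<in> generic_pictures (cycle_graph n)"
        using irreducible_in_generic_pictures[OF n inf m] unfolding irreducible_in_def by blast
      obtain p l where pl: "P = (p, l)" by fastforce
      have inj: "inj_on p {..<n}"
        using P unfolding pl generic_pictures_def verts_cycle by simp
      have "\<forall>v\<in>{..<n}. \<forall>w\<in>{..<n}. p v = p w"
        using subsetD[OF sub P]
        unfolding pl I_def indiscrete_cellule_def verts_cycle mem_Collect_eq prod.case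
        by (rule conjunct2)
      moreover have "0 \<in> {..<n}" "1 \<in> {..<n}"
        using n by simp_all
      ultimately have "p 0 = p 1" by blast
      with inj have "(0::nat) = 1"
        by (rule inj_onD) (use n in simp_all)
      then show False by simp
    qed
    \<comment> \<open>\<open>V\<close> and \<open>I\<close> are closed and cover the space, so
      irreducibility of \<open>T\<close> puts it into one of them. With neither containing the
      other, they are exactly the maximal irreducible sets.\<close>
    have comp: "T \<subseteq> V \<or> T \<subseteq> I" if "irreducible_in X T" for T
    proof -
      have "T \<subseteq> V \<union> I"
        using that cover unfolding irreducible_in_def top by blast
      with that V_closed I_closed show ?thesis
        unfolding irreducible_in_def by blast
    qed
    have "irreducible_components X = {V, I}"
    proof (rule set_eqI, rule iffI)
      fix T assume "T \<in> irreducible_components X"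
      then have T: "irreducible_in X T" "\<And>U. irreducible_in X U \<Longrightarrow> T \<subseteq> U \<Longrightarrow> U = T"
        unfolding irreducible_components_def by simp_all
      show "T \<in> {V, I}"
        using comp[OF T(1)] T(2)[OF V_irr] T(2)[OF I_irr] by blast
    next
      fix T assume "T \<in> {V, I}"
      then have T: "irreducible_in X T" "T = V \<or> T = I"
        using V_irr I_irr by auto
      have "U = T" if "irreducible_in X U" "T \<subseteq> U" for U
        using comp[OF that(1)] that(2) T(2) IV VI by blast
      with T(1) show "T \<in> irreducible_components X"
        unfolding irreducible_components_def by simp
    qed
    with IV show ?thesis by blast
  qed
  ultimately show ?thesis
    unfolding V_def I_def by blast
qed

end
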